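(* The complexity of (1,2)Insertion$^*$ is at most $n\lg n -1.4034n$.
   Context: Complexity means the expected number of comparisons over all $n!$ orderings of $n$ distinct input elements; $n$ even, $O(\log n)$ terms ignored. $\lg=\log_2$, $p_x = x/2^{\lceil \lg x\rceil}$. RHBS$(A,T)$, $T=(t_1,\dots,t_i)$ sorted: if $i\le 3\cdot 2^{\lceil\lg(i+1)\rceil-2}-1$ let $d=2^{\lceil\lg(i+1)\rceil-2}$, else $d=i-2^{\lceil\lg(i+1)\rceil-1}+1$; compare $A$ with $t_d$ and recurse on the left or right part. 2Merge$^*(A,B,T)$, $T=(t_1,\dots,t_{i-2})$ sorted, $i$ even $\ge4$: Step 1 compare and swap so $A<B$. Step 2: for $r=1,2,\dots$ up to $2\lg i$ compare $A$ with $t_{\lceil\alpha(r,p_i)i\rceil}$, stopping at the first $r$ with $A<t_{\lceil\alpha(r,p_i)i\rceil}$, where for $r=2k-1$: $\alpha=1-2^{-(k-1)}+\frac{1}{p_i2^{k+1}}$ if $p_i\in(3/4,1]$ and $\alpha=1-2^{-k}-\frac{1}{p_i2^{k+2}}$ if $p_i\in(1/2,3/4]$; for $r=2k$: $\alpha=1-2^{-k}$. Step 3: insert $A$ into $(t_{\lceil\alpha(r-1,p_i)i\rceil+1},\dots,t_{\lceil\alpha(r,p_i)i\rceil-1})$ by RHBS, say between $t_\ell,t_{\ell+1}$. Step 4: insert $B$ into $(t_{\ell+1},\dots,t_{i-2})$ by RHBS. (1,2)Insertion$^*(S)$, $S=(s_1,\dots,s_n)$, $n$ even: if $n=2$ sort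 with one comparison; otherwise sort $(s_1,\dots,s_{n-2})$ recursively to get $T'$; if $p_n\in[\frac34-\frac{\sqrt6}{12},\frac34+\frac{\sqrt3}{12}]$ insert $s_{n-1},s_n$ by 2Merge$^*(s_{n-1},s_n,T')$, otherwise insert $s_{n-1}$ and then $s_n$ by RHBS. *)

theory Defs
  imports Complex_Main "HOL-Combinatorics.Multiset_Permutations"
begin

(* Inputs are modelled as lists of distinct naturals (a permutation of {0..<n});
   since the algorithms are comparison based, only the relative order matters.
   The functions below count the comparisons performed. *)

definition pfrac :: "nat \<Rightarrow> real" where
  "pfrac x = real x / 2 powr (real_of_int \<lceil>log 2 (real x)\<rceil>)"

(* pivot index d of RHBS for a sorted list of length i (1-indexed) *)
definition rhbs_pivot :: "nat \<Rightarrow> nat" where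
  "rhbs_pivot i = (let c = nat \<lceil>log 2 (real i + 1)\<rceil> in
     if 4 * (i + 1) \<le> 3 * 2 ^ c then 2 ^ (c - 2) else i + 1 - 2 ^ (c - 1))"

(* number of comparisons used by RHBS(a, ts); the clamp of d into [1, i] is
   never active (d always lies in that range) and only eases termination *)
function rhbs :: "nat \<Rightarrow> nat list \<Rightarrow> nat" where
  "rhbs a ts = (if ts = [] then 0 else
     (let i = length ts; d = max 1 (min (rhbs_pivot i) i) in
      Suc (if a < ts ! (d - 1) then rhbs a (take (d - 1) ts) else rhbs a (drop d ts))))"
  by pat_completeness auto
termination by (relation "measure (\<lambda>(a, ts). length ts)") (auto simp: min_def max_def)

definition alpha :: "nat \<Rightarrow> real \<Rightarrow> real" where
  "alpha r p = (if even r then 1 - 1 / 2 ^ (r div 2)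
     else (let k = (r + 1) div 2 in
       if p > 3/4 then 1 - 1 / 2 ^ (k - 1) + 1 / (p * 2 ^ (k + 1))
       else 1 - 1 / 2 ^ k - 1 / (p * 2 ^ (k + 2))))"

(* Step 2 of 2Merge*: probes r, r+1, ... (at most k more probes).
   Returns (number of comparisons, lo, hi) where a lies strictly between
   t_lo and t_hi (t_0 = -infinity, t_j = +infinity for j > length ts).
   A probe index beyond the list is treated as the sentinel +infinity:
   the search stops there without a comparison. *)
primrec tm_search :: "nat \<Rightarrow> nat list \<Rightarrow> (nat \<Rightarrow> nat) \<Rightarrow> nat \<Rightarrow> nat \<Rightarrow> nat \<Rightarrow> nat \<times> nat \<times> nat" where
  "tm_search a ts idx 0 r lo = (0, lo, length ts + 1)"
| "tm_search a ts idx (Suc k) r lo =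
     (let j = idx r in
      if length ts < j then (0, lo, j)
      else if a < ts ! (j - 1) then (1, lo, j)
      else (case tm_search a ts idx k (Suc r) j of (c, l, h) \<Rightarrow> (Suc c, l, h)))"

definition twomerge :: "nat \<Rightarrow> nat \<Rightarrow> nat list \<Rightarrow> nat" where
  "twomerge a0 b0 ts = (let i = length ts + 2; a = min a0 b0; b = max a0 b0;
     p = pfrac i; idx = (\<lambda>r. nat \<lceil>alpha r p * real i\<rceil>);
     R = nat \<lfloor>2 * log 2 (real i)\<rfloor>;
     (c, lo, hi) = tm_search a ts idx R 1 0;
     seg = drop lo (take (min (hi - 1) (length ts)) ts);
     l = length (filter (\<lambda>t. t < a) ts)
   in 1 + c + rhbs a seg + rhbs b (drop l ts))"

definition use_2merge :: "nat \<Rightarrow> bool" where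
  "use_2merge n \<longleftrightarrow> 3/4 - sqrt 6 / 12 \<le> pfrac n \<and> pfrac n \<le> 3/4 + sqrt 3 / 12"

(* number of comparisons of (1,2)Insertion*(s); the recursively produced
   sorted list is sort (take (n-2) s), as the algorithm is correct *)
function ins12 :: "nat list \<Rightarrow> nat" where
  "ins12 s = (let n = length s in
     if n \<le> 2 then (if n = 2 then 1 else 0)
     else (let T = sort (take (n - 2) s); a = s ! (n - 2); b = s ! (n - 1) in
       ins12 (take (n - 2) s) +
       (if use_2merge n then twomerge a b T else rhbs a T + rhbs b (insort a T))))"
  by pat_completeness auto
termination by (relation "measure length") auto

definition complexity :: "nat \<Rightarrow> real" where
  "complexity n = (\<Sum>s\<in>permutations_of_set {0..<n}. real (ins12 s)) / fact n"

end

theory Submission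
  imports Defs "HOL-Analysis.Analysis"
begin

text \<open>
  Inserting into a sorted list by RHBS depends only on the gap hit, and the shallow leaves of the
  decision tree are the leftmost gaps. In 2Merge* the smaller element is searched in stages that
  halve the remaining list, and its cost is a constant plus the number of stage thresholds that its
  gap lies beyond; averaging over all pairs of ranks gives, with \<open>2 ^ c / 2 < n \<le> 2 ^ c\<close>,
  a pair-insertion cost of \<open>2 * (c + 1 - 2 ^ c / n) + gain (n / 2 ^ c) + O(1 / n)\<close>.
  Summing over even sizes compares with an integral, the potential, whose excess over the claimed
  bound is \<open>2 ^ c\<close> times a function of \<open>n / 2 ^ c\<close>. That function is negative on
  \<open>[1/2, 1]\<close>, by only about \<open>0.00002\<close> near \<open>0.904\<close>; this is
  checked by replacing logarithms with cubic upper bounds and reading off Bernstein coefficients.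
\<close>

text \<open>Because \<open>alpha\<close> divides by \<open>p\<close>, one of the two pieces of every
  stage has exactly a power of two of gaps: the first if \<open>p > 3/4\<close>, the second
  otherwise. RHBS is uniform on it. Passing a stage costs two probes, but the remaining list halves
  and saves one comparison of RHBS; the net loss of one is what a threshold counts. The end points
  of the range in \<open>use_2merge\<close> are the roots where the limiting gain of 2Merge* changes
  sign, so a minimum with 0 models the choice made by the algorithm. The potential lives on octaves
  between powers of two, with constants that make neighbouring octaves agree at their common end. As
  \<open>n\<close> is even, the step from \<open>n - 2\<close> to \<open>n\<close> never straddles a
  power of two. Rounding and the passage from sums to integrals cost O(1/n) per pair, and these
  errors add up to the logarithmic term. The tiny margin forces six-digit bounds on logarithms and
  an expansion point, \<open>181/200\<close>, next to the critical place.\<close>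

section \<open>Cost of RHBS as a function of the gap hit\<close>

definition gap :: "nat \<Rightarrow> nat list \<Rightarrow> nat \<Rightarrow> bool" where
  "gap a ts g \<longleftrightarrow> g \<le> length ts \<and> (\<forall>j<length ts. a < ts ! j \<longleftrightarrow> g \<le> j)"

lemma gap_segment:
  assumes "gap a ts g" "lo \<le> g" "g \<le> hi" "hi \<le> length ts"
  shows "gap a (drop lo (take hi ts)) (g - lo)"
  using assms by (auto simp: gap_def)

lemma gap_drop:
  assumes "gap a ts g" "lo \<le> g"
  shows "gap a (drop lo ts) (g - lo)"
  using assms by (auto simp: gap_def)

lemma gap_take:
  assumes "gap a ts g" "g \<le> hi" "hi \<le> length ts"
  shows "gap a (take hi ts) g"
  using assms by (auto simp: gap_def)

text \<open>\<open>N\<close> counts gaps, one more than the length of the list. The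
  \<open>2 ^ C - N\<close> leftmost gaps are the leaves of depth \<open>C - 1\<close>; the condition
  is written additively to stay clear of truncated subtraction.\<close>

definition rhbs_gap_cost :: "nat \<Rightarrow> nat \<Rightarrow> nat \<Rightarrow> nat" where
  "rhbs_gap_cost C N g = (if g + N < 2 ^ C then C - 1 else C)"

declare rhbs.simps [simp del]

lemma rhbs_step:
  assumes "ts \<noteq> []" "d = max 1 (min (rhbs_pivot (length ts)) (length ts))"
  shows "rhbs a ts = Suc (if a < ts ! (d - 1) then rhbs a (take (d - 1) ts) else rhbs a (drop d ts))"
  using assms(1) unfolding assms(2) by (subst rhbs.simps) (simp only: Let_def if_False)

lemma rhbs_le_length: "rhbs a ts \<le> length ts"
proof (induction ts rule: measure_induct_rule[of length])
  case (less ts)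
  show ?case
  proof (cases "ts = []")
    case False
    define d where "d = max 1 (min (rhbs_pivot (length ts)) (length ts))"
    have d: "1 \<le> d" "d \<le> length ts" using False by (auto simp: d_def Suc_le_eq)
    have "rhbs a (take (d - 1) ts) \<le> d - 1" "rhbs a (drop d ts) \<le> length ts - d"
      using less[of "take (d-1) ts"] less[of "drop d ts"] d by auto
    then show ?thesis using d unfolding rhbs_step[OF False d_def, of a] by auto
  qed (simp add: rhbs.simps)
qed

lemma rhbs_pivot_eq:
  assumes "2 ^ C < Suc i" "Suc i \<le> 2 ^ Suc C"
  shows "rhbs_pivot i = (if 4 * (i + 1) \<le> 3 * 2 ^ Suc C then 2 ^ (C - 1) else i + 1 - 2 ^ C)"
proof -
  have "\<lceil>log (real 2) (real (Suc i))\<rceil> = int C + 1"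
    by (rule ceiling_log_nat_eq_if) (use assms in auto)
  then have "nat \<lceil>log 2 (real i + 1)\<rceil> = Suc C"
    by (simp add: add.commute)
  then show ?thesis
    unfolding rhbs_pivot_def by (auto simp: Let_def)
qed

lemma rhbs_cost:
  assumes "gap a ts g" "2 ^ C \<le> 2 * Suc (length ts)" "Suc (length ts) \<le> 2 ^ C"
  shows "rhbs a ts = rhbs_gap_cost C (Suc (length ts)) g"
  using assms
proof (induction ts arbitrary: g C rule: measure_induct_rule[of length])
  case (less ts)
  define i where "i = length ts"
  have g: "g \<le> i" using less.prems by (simp add: gap_def i_def)
  have strict: "rhbs a ts = rhbs_gap_cost C' (Suc i) g"
    if C': "2 ^ C' < 2 * Suc i" "Suc i \<le> 2 ^ C'" for C'
  proof (cases "i = 0")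
    case True
    then have "C' = 0" using C' by (cases C') auto
    then show ?thesis using True by (simp add: rhbs.simps i_def rhbs_gap_cost_def)
  next
    case False
    then obtain D where D: "C' = Suc D" using C' by (cases C') auto
    have D1: "2 ^ D < Suc i" "Suc i \<le> 2 ^ Suc D" using C' D by auto
    define d where "d = rhbs_pivot i"
    have d: "d = (if 4 * (i + 1) \<le> 3 * 2 ^ Suc D then 2 ^ (D - 1) else i + 1 - 2 ^ D)"
      unfolding d_def by (rule rhbs_pivot_eq[OF D1])
    have d1: "1 \<le> d" "d \<le> i"
      using D1 False unfolding d by (cases D; auto)+
    have unf: "rhbs a ts = Suc (if a < ts ! (d - 1) then rhbs a (take (d - 1) ts) else rhbs a (drop d ts))"
      by (rule rhbs_step) (use False d1 in \<open>auto simp: i_def d_def max_def min_def\<close>)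
    have split: "a < ts ! (d - 1) \<longleftrightarrow> g < d"
      using less.prems(1) d1 by (auto simp: gap_def i_def)
    have L: "rhbs a (take (d - 1) ts) = rhbs_gap_cost E d g"
      if "g < d" "2 ^ E \<le> 2 * d" "d \<le> 2 ^ E" for E
      using less.IH[of "take (d - 1) ts" g E] that d1 gap_take[OF less.prems(1), of "d - 1"]
      by (auto simp: i_def)
    have R: "rhbs a (drop d ts) = rhbs_gap_cost E (Suc i - d) (g - d)"
      if "d \<le> g" "2 ^ E \<le> 2 * (Suc i - d)" "Suc i - d \<le> 2 ^ E" for E
      using less.IH[of "drop d ts" "g - d" E] that d1 gap_drop[OF less.prems(1), of d]
      by (auto simp: i_def Suc_diff_le)
    show ?thesis
    \<comment> \<open>Up to three quarters of \<open>2 ^ C'\<close> the left subtree is perfect with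
      a quarter of \<open>2 ^ C'\<close> gaps; beyond that the right subtree is perfect with half of
      \<open>2 ^ C'\<close> gaps.\<close>
    proof (cases "4 * (i + 1) \<le> 3 * 2 ^ Suc D")
      case True
      with D1 False obtain F where F: "D = Suc F" by (cases D) auto
      have dF: "d = 2 ^ F" using d True F by simp
      define x :: nat where "x = 2 ^ F"
      have x: "2 ^ F = x" "2 ^ D = 2 * x" "2 ^ C' = 4 * x" by (simp_all add: x_def F D)
      have b: "2 * x < Suc i" "Suc i \<le> 3 * x" "d = x" using D1 True dF by (simp_all add: x F)
      show ?thesis
      proof (cases "g < d")
        case True
        have "rhbs a ts = Suc F" using unf split True L[of F] b x by (simp add: rhbs_gap_cost_def)
        then show ?thesis using True b x F D by (simp add: rhbs_gap_cost_def)
      next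
        case False
        have "rhbs a ts = Suc (rhbs_gap_cost D (Suc i - d) (g - d))"
          using unf split False R[of D] b x by simp
        then show ?thesis using False b x F D by (simp add: rhbs_gap_cost_def; linarith)
      qed
    next
      case c2: False
      have dF: "d = i + 1 - 2 ^ D" using d c2 by simp
      define x :: nat where "x = 2 ^ D"
      have x: "2 ^ D = x" "2 ^ C' = 2 * x" by (simp_all add: x_def D)
      have b: "3 * x < 2 * Suc i" "Suc i \<le> 2 * x" "d = Suc i - x" using D1 c2 dF by (simp_all add: x)
      have "x \<le> Suc i" using b by simp
      then have si0: "Suc i = x + d" using b by simp
      have si: "Suc i = x + d" "d \<le> x" "x < 2 * d" using b(1,2) unfolding si0 by simp_all
      show ?thesis
      proof (cases "g < d")
        case True
        have *: "rhbs a ts = Suc (rhbs_gap_cost D d g)" using unf split True L[of D] si x by simp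
        \<comment> \<open>The depth \<open>C - 1\<close> is truncated at 0, and
          \<open>Suc (D - 1) = D\<close> would fail for \<open>D = 0\<close>.\<close>
        have "D \<noteq> 0" if "g + d < x" using d1 x that by (cases D) simp_all
        moreover have "g + d < x \<longleftrightarrow> g + Suc i < 2 * x" using si by linarith
        ultimately show ?thesis using * x D by (simp add: rhbs_gap_cost_def)
      next
        case False
        have "rhbs a ts = Suc (rhbs_gap_cost D (Suc i - d) (g - d))"
          using unf split False R[of D] si x by simp
        moreover have "\<not> g - d + (Suc i - d) < x" "\<not> g + Suc i < 2 * x" using si False by simp_all
        ultimately show ?thesis using x D by (simp add: rhbs_gap_cost_def)
      qed
    qed
  qed
  show ?case
  proof (cases "2 ^ C = 2 * Suc i")
    case True
    then obtain D where D: "C = Suc D" by (cases C) auto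
    have "rhbs a ts = rhbs_gap_cost D (Suc i) g" using True D by (intro strict) auto
    moreover have "g + Suc i < 2 ^ C" "\<not> g + Suc i < 2 ^ D" using True D g by auto
    ultimately show ?thesis using D by (simp add: rhbs_gap_cost_def i_def)
  next
    case False
    then show ?thesis using strict[of C] less.prems by (auto simp: i_def)
  qed
qed

text \<open>The external path length of a binary tree with \<open>N\<close> leaves on the levels
  \<open>C - 1\<close> and \<open>C\<close>.\<close>

lemma rhbs_gap_cost_sum:
  assumes "2 ^ C \<le> 2 * N" "N \<le> 2 ^ C"
  shows "(\<Sum>g<N. real (rhbs_gap_cost C N g)) = real N * (real C + 1) - 2 ^ C"
proof -
  have *: "{..<N} = {..<2^C - N} \<union> {2^C - N..<N}" using assms by auto
  have "(\<Sum>g<N. real (rhbs_gap_cost C N g)) =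
      (\<Sum>g<2^C - N. real (C - 1)) + (\<Sum>g=2^C - N..<N. real C)"
    unfolding * by (subst sum.union_disjoint, simp, simp, force)
      (intro arg_cong2[where f = "(+)"] sum.cong refl; auto simp: rhbs_gap_cost_def)
  also have "\<dots> = real (2^C - N) * real (C - 1) + real (N - (2^C - N)) * real C" by simp
  also have "\<dots> = real N * (real C + 1) - 2 ^ C"
  proof (cases C)
    case 0
    then show ?thesis using assms by auto
  next
    case (Suc D)
    then show ?thesis using assms by (simp add: algebra_simps)
  qed
  finally show ?thesis .
qed

section \<open>The staged search for the smaller element in 2Merge*\<close>

text \<open>Steps 2 and 3 of 2Merge* taken together, resumed at probe \<open>r\<close> with lower
  end \<open>lo\<close>, so that stages can be peeled off one at a time.\<close>

definition search_cost :: "nat \<Rightarrow> nat list \<Rightarrow> (nat \<Rightarrow> nat) \<Rightarrow> nat \<Rightarrow> nat \<Rightarrow> nat \<Rightarrow> nat" where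
  "search_cost a ts idx K r lo = (case tm_search a ts idx K r lo of (c, l, h) \<Rightarrow>
     c + rhbs a (drop l (take (min (h - 1) (length ts)) ts)))"

lemma rhbs_segment_le: "rhbs a (drop l (take h ts)) \<le> length ts"
  using rhbs_le_length[of a "drop l (take h ts)"] by auto

lemma search_cost_le: "search_cost a ts idx K r lo \<le> K + length ts"
proof (induction K arbitrary: r lo)
  case 0
  then show ?case using rhbs_segment_le[of a lo "length ts" ts] by (simp add: search_cost_def)
next
  case (Suc K)
  show ?case
    using Suc[of "Suc r" "idx r"] rhbs_segment_le[of a lo _ ts] rhbs_segment_le[of a lo "length ts" ts]
    by (auto simp: search_cost_def Let_def split: prod.splits intro: le_SucI trans_le_add2)
qed

text \<open>Strictly between positions \<open>lo\<close> and \<open>idx r\<close> lie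
  \<open>idx r - lo - 1\<close> elements, hence \<open>idx r - lo\<close> gaps.\<close>

lemma search_cost_stop:
  assumes "gap a ts g" "lo \<le> g" "g < idx r" "idx r \<le> length ts"
    and "2 ^ C \<le> 2 * (idx r - lo)" "idx r - lo \<le> 2 ^ C"
  shows "search_cost a ts idx (Suc K) r lo = Suc (rhbs_gap_cost C (idx r - lo) (g - lo))"
proof -
  define j where "j = idx r"
  have "a < ts ! (j - 1)" using assms by (auto simp: gap_def j_def)
  then have "search_cost a ts idx (Suc K) r lo = Suc (rhbs a (drop lo (take (j - 1) ts)))"
    using assms by (simp add: search_cost_def j_def min_def)
  also have "rhbs a (drop lo (take (j - 1) ts)) = rhbs_gap_cost C (Suc (j - 1 - lo)) (g - lo)"
    using rhbs_cost[of a "drop lo (take (j - 1) ts)" "g - lo" C] gap_segment[OF assms(1,2), of "j - 1"] assms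
    by (auto simp: j_def Suc_diff_le)
  also have "Suc (j - 1 - lo) = j - lo" using assms by (simp add: j_def)
  finally show ?thesis by (simp add: j_def)
qed

lemma search_cost_next:
  assumes "gap a ts g" "0 < idx r" "idx r \<le> g" "idx r \<le> length ts"
  shows "search_cost a ts idx (Suc K) r lo = Suc (search_cost a ts idx K (Suc r) (idx r))"
proof -
  have "\<not> a < ts ! (idx r - 1)" using assms by (auto simp: gap_def)
  then show ?thesis
    using assms by (simp add: search_cost_def split: prod.splits)
qed

text \<open>Stopping in stage \<open>m\<close> costs \<open>2 * m\<close> earlier probes plus at
  most \<open>c - e - m\<close>, possibly plus one. So the excess over \<open>c - e\<close> is
  \<open>m\<close> or \<open>m + 1\<close>, and this is the number of thresholds passed, since a gap
  that has reached stage \<open>m\<close> lies beyond all earlier ones. The stage analysis enters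
  only through the hypotheses \<open>stop\<close> and \<open>next\<close>.\<close>

lemma search_cost_bound:
  fixes n c e R g :: nat and z :: "nat \<Rightarrow> nat"
  assumes len: "length ts \<le> n" and R: "2 * (c - 2) \<le> R" "R \<le> 2 * n"
    and c: "2 \<le> c" "n \<le> 2 ^ c"
    and z: "\<And>m. m + 3 \<le> c \<Longrightarrow> n div 2 ^ Suc m \<le> z m"
    and stop: "\<And>m K. \<lbrakk>m + 3 \<le> c; n - n div 2 ^ m \<le> g; g < n - n div 2 ^ Suc m\<rbrakk> \<Longrightarrow>
      search_cost a ts idx (Suc (Suc K)) (2 * m + 1) (n - n div 2 ^ m) + m
        \<le> c - e + (if n \<le> g + z m then 1 else 0)"
    and "next": "\<And>m K. \<lbrakk>m + 3 \<le> c; n - n div 2 ^ m \<le> g; n - n div 2 ^ Suc m \<le> g\<rbrakk> \<Longrightarrow>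
      search_cost a ts idx (Suc (Suc K)) (2 * m + 1) (n - n div 2 ^ m)
        = 2 + search_cost a ts idx K (2 * Suc m + 1) (n - n div 2 ^ Suc m)"
  shows "search_cost a ts idx R 1 0
    \<le> c - e + (\<Sum>k<c - 2. if n \<le> g + z k then 1 else 0) + (if n \<le> g + 4 then 3 * n else 0)"
proof -
  define S where "S = (\<Sum>k<c - 2. if n \<le> g + z k then 1 else (0::nat))"
  \<comment> \<open>All \<open>k < m\<close> count because the hypothesis on \<open>z\<close> places
    every gap past stage \<open>k\<close> beyond the threshold of stage \<open>k\<close>; the
    indicator adds stage \<open>m\<close> itself.\<close>
  have S: "m + (if m + 3 \<le> c \<and> n \<le> g + z m then 1 else 0) \<le> S" if "m \<le> c - 2" "n - n div 2 ^ m \<le> g" for m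
  proof -
    have k: "n \<le> g + z k" if "k < m" for k
    proof -
      have "n div 2 ^ m \<le> n div 2 ^ Suc k" by (rule div_le_mono2, simp, rule power_increasing) (use that in auto)
      also have "\<dots> \<le> z k" using z[of k] that \<open>m \<le> c - 2\<close> c by simp
      finally show ?thesis using \<open>n - n div 2 ^ m \<le> g\<close> by simp
    qed
    define X where "X = (if m + 3 \<le> c \<and> n \<le> g + z m then {..m} else {..<m})"
    have "n \<le> g + z k" if "k \<in> X" for k
      using k[of k] that by (cases "k = m") (auto simp: X_def split: if_splits)
    then have "card X = (\<Sum>k\<in>X. if n \<le> g + z k then 1 else 0)"
      by simp
    also have "\<dots> \<le> S" unfolding S_def
      by (rule sum_mono2) (use \<open>m \<le> c - 2\<close> in \<open>auto simp: X_def\<close>)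
    finally show ?thesis by (auto simp: X_def)
  qed
  have *: "search_cost a ts idx (R - 2 * m) (2 * m + 1) (n - n div 2 ^ m) + 2 * m
      \<le> c - e + S + (if n \<le> g + 4 then 3 * n else 0)"
    if "m \<le> c - 2" "n - n div 2 ^ m \<le> g" for m
    using that
  proof (induction m rule: inc_induct)
    \<comment> \<open>After \<open>c - 2\<close> stages at most four gaps remain. They are charged
      the crude \<open>3 * n\<close>, from at most \<open>2 * n\<close> probes and a segment of
      length at most \<open>n\<close>; only a bounded number of pairs of ranks is affected.\<close>
    case base
    have "n \<le> 2 ^ (c - 2) * 4" using c by (cases c; cases "c - 1") auto
    then have "n div 2 ^ (c - 2) \<le> 4" by (metis div_le_mono nonzero_mult_div_cancel_left power_not_zero zero_neq_numeral)
    then have "n \<le> g + 4" using base by simp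
    then show ?case
      using search_cost_le[of a ts idx "R - 2 * (c - 2)" "2 * (c - 2) + 1" "n - n div 2 ^ (c - 2)"] R len
      by (simp only: if_True) linarith
  next
    case (step m)
    define K where "K = R - 2 * Suc m"
    have K: "R - 2 * m = Suc (Suc K)" "R - 2 * Suc m = K"
      using step.hyps R unfolding K_def by arith+
    have m: "m + 3 \<le> c" using step.hyps by simp
    show ?case
    proof (cases "g < n - n div 2 ^ Suc m")
      case True
      show ?thesis using stop[OF m step.prems True, of K] S[OF _ step.prems] step.hyps m K by auto
    next
      case False
      show ?thesis using "next"[OF m step.prems, of K] step.IH False K by auto
    qed
  qed
  show ?thesis using *[of 0] by (simp add: S_def)
qed

lemma ceil_log_eq:
  assumes "2 ^ c < 2 * n" "n \<le> 2 ^ c" "2 \<le> n"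
  shows "\<lceil>log 2 (real n)\<rceil> = int c"
proof -
  from assms obtain d where d: "c = Suc d" by (cases c) auto
  have "\<lceil>log (real 2) (real n)\<rceil> = int d + 1"
    by (rule ceiling_log_nat_eq_if) (use assms d in auto)
  then show ?thesis by (simp add: d)
qed

lemma pfrac_eq:
  assumes "2 ^ c < 2 * n" "n \<le> 2 ^ c" "2 \<le> n"
  shows "pfrac n = real n / 2 ^ c"
  unfolding pfrac_def ceil_log_eq[OF assms] by (simp add: powr_realpow)

lemma ceiling_diff_div:
  "\<lceil>real_of_int x - real n / 2 ^ k\<rceil> = x - int (n div 2 ^ k)"
proof -
  have "\<lfloor>real n / 2 ^ k\<rfloor> = int (n div 2 ^ k)"
    using floor_divide_of_nat_eq[of n "2 ^ k", where ?'a = real] by simp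
  then show ?thesis by (simp add: ceiling_def)
qed

lemma probe_even: "nat \<lceil>alpha (2 * Suc m) p * real n\<rceil> = n - n div 2 ^ Suc m"
proof -
  have "alpha (2 * Suc m) p * real n = real_of_int (int n) - real n / 2 ^ Suc m"
    by (simp add: alpha_def algebra_simps)
  then show ?thesis by (simp only: ceiling_diff_div)
qed

text \<open>The quotient \<open>n / p\<close> is \<open>2 ^ c\<close>, so the offset of this probe
  from the start of the stage is exactly \<open>2 ^ (q + 1)\<close>: the first piece is a perfect
  tree.\<close>

lemma probe_odd_high:
  assumes "c = m + q + 3" "0 < n" "p = real n / 2 ^ c" "3/4 < p"
  shows "nat \<lceil>alpha (2 * m + 1) p * real n\<rceil> = n - n div 2 ^ m + 2 * 2 ^ q"
proof -
  have "alpha (2 * m + 1) p * real n = (1 - 1 / 2 ^ m + 1 / (p * 2 ^ (m + 2))) * real n"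
    using assms by (simp add: alpha_def Let_def)
  also have "\<dots> = real n - real n / 2 ^ m + 2 * 2 ^ q"
    using assms(2) unfolding assms(3) assms(1) by (simp add: field_simps power_add)
  also have "\<dots> = real_of_int (int n + 2 * 2 ^ q) - real n / 2 ^ m"
    by simp
  finally have "\<lceil>alpha (2 * m + 1) p * real n\<rceil> = int n + 2 * 2 ^ q - int (n div 2 ^ m)"
    by (simp only: ceiling_diff_div)
  also have "\<dots> = int (n - n div 2 ^ m + 2 * 2 ^ q)"
    using div_le_dividend[of n "2 ^ m"] by (simp del: div_le_dividend)
  finally show ?thesis by (simp only: nat_int)
qed

text \<open>Here the exact power of two is measured back from the end of the stage, so it is the
  second piece that is a perfect tree, with \<open>2 ^ q\<close> gaps.\<close>

lemma probe_odd_low: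
  assumes "c = m + q + 3" "0 < n" "p = real n / 2 ^ c" "p \<le> 3/4"
  shows "nat \<lceil>alpha (2 * m + 1) p * real n\<rceil> = n - n div 2 ^ Suc m - 2 ^ q"
proof -
  have "alpha (2 * m + 1) p * real n = (1 - 1 / 2 ^ Suc m - 1 / (p * 2 ^ (m + 3))) * real n"
    using assms by (simp add: alpha_def Let_def power_add power3_eq_cube)
  also have "\<dots> = real n - real n / 2 ^ Suc m - 2 ^ q"
    using assms(2) unfolding assms(3) assms(1) by (simp add: field_simps power_add)
  also have "\<dots> = real_of_int (int n - 2 ^ q) - real n / 2 ^ Suc m"
    by simp
  finally have "\<lceil>alpha (2 * m + 1) p * real n\<rceil> = int n - 2 ^ q - int (n div 2 ^ Suc m)"
    by (simp only: ceiling_diff_div)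
  also have "\<dots> = int n - int (n div 2 ^ Suc m) - int (2 ^ q)"
    by simp
  finally have *: "\<lceil>alpha (2 * m + 1) p * real n\<rceil> = int n - int (n div 2 ^ Suc m) - int (2 ^ q)" .
  have "nat (int x - int y - int z) = x - y - z" for x y z
    by linarith
  then show ?thesis unfolding * .
qed

definition probe :: "nat \<Rightarrow> nat \<Rightarrow> nat" where
  "probe n r = nat \<lceil>alpha r (pfrac n) * real n\<rceil>"

text \<open>Stage \<open>m\<close> is the pair of probes \<open>2 * m + 1\<close> and \<open>2 * m + 2\<close>; it costs one more comparison exactly for the gaps
  within the last \<open>threshold e c n m\<close> ones.\<close>

definition threshold :: "nat \<Rightarrow> nat \<Rightarrow> nat \<Rightarrow> nat \<Rightarrow> nat" where
  "threshold e c n m = 2 * (n div 2 ^ m) - n div 2 ^ Suc m - 3 * 2 ^ (c - Suc m - e)"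

text \<open>This makes the thresholds compatible with the stages: whoever leaves stage
  \<open>m\<close> has already passed its threshold.\<close>

lemma threshold_ge:
  assumes n: "2 ^ c < 2 * n" and m: "m + 3 \<le> c"
    and e: "e = (if 3 * 2 ^ c < 4 * n then 1 else 2)"
  shows "n div 2 ^ Suc m \<le> threshold e c n m"
proof -
  obtain q where q: "c = m + q + 3" using m by (metis add.commute add.assoc le_Suc_ex)
  define Q where "Q = (2::nat) ^ q"
  have Q: "2 ^ c = 8 * Q * 2 ^ m" by (auto simp: Q_def q power_add)
  define A where "A = n div 2 ^ m"
  have A: "n < (A + 1) * 2 ^ m"
    by (simp add: A_def dividend_less_div_times add.commute)
  have BA: "n div 2 ^ Suc m = A div 2" by (simp add: A_def div_mult2_eq mult.commute[of 2])
  have th: "threshold e c n m = 2 * A - A div 2 - 3 * 2 ^ (c - Suc m - e)"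
    unfolding threshold_def BA by (simp add: A_def)
  show ?thesis
  proof (cases "3 * 2 ^ c < 4 * n")
    case True
    have "6 * Q * 2 ^ m < (A + 1) * 2 ^ m" using True Q A by linarith
    then have "6 * Q \<le> A" by (simp only: mult_less_cancel2) simp
    moreover have "threshold e c n m = 2 * A - A div 2 - 6 * Q"
      unfolding th using e True by (simp add: q Q_def)
    ultimately show ?thesis unfolding BA by linarith
  next
    case False
    have "4 * Q * 2 ^ m < (A + 1) * 2 ^ m" using n(1) Q A by linarith
    then have "4 * Q \<le> A" by (simp only: mult_less_cancel2) simp
    moreover have "threshold e c n m = 2 * A - A div 2 - 3 * Q"
      unfolding th using e False by (simp add: q Q_def)
    ultimately show ?thesis unfolding BA by linarith
  qed
qed

text \<open>Stage \<open>m\<close> occupies the gaps from \<open>n - A\<close> to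
  \<open>n - B\<close>, with \<open>A = n div 2 ^ m\<close> and \<open>B = A div 2\<close>. Its
  cheapest gaps cost \<open>c - e - m\<close> comparisons; the threshold formula is the place where
  the shallow leaves of the imperfect piece end. The subtracted
  \<open>3 * 2 ^ (c - Suc m - e)\<close> is \<open>6 * Q\<close> for \<open>e = 1\<close> and
  \<open>3 * Q\<close> for \<open>e = 2\<close>.\<close>

lemma stage_search:
  fixes c n e m g :: nat
  assumes n: "2 ^ c < 2 * n" "n \<le> 2 ^ c" and m: "m + 3 \<le> c"
    and e: "e = (if 3 * 2 ^ c < 4 * n then 1 else 2)"
    and gap: "gap a ts g" "length ts = n - 2"
    and lo: "n - n div 2 ^ m \<le> g"
  shows "g < n - n div 2 ^ Suc m \<Longrightarrow>
      search_cost a ts (probe n) (Suc (Suc K)) (2 * m + 1) (n - n div 2 ^ m) + m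
        \<le> c - e + (if n \<le> g + threshold e c n m then 1 else 0)"
    and "n - n div 2 ^ Suc m \<le> g \<Longrightarrow>
      search_cost a ts (probe n) (Suc (Suc K)) (2 * m + 1) (n - n div 2 ^ m)
        = 2 + search_cost a ts (probe n) K (2 * Suc m + 1) (n - n div 2 ^ Suc m)"
proof -
  obtain q where q: "c = m + q + 3" using m by (metis add.commute add.assoc le_Suc_ex)
  define Q where "Q = (2::nat) ^ q"
  have Q: "0 < Q" "2 ^ c = 8 * Q * 2 ^ m" "2 ^ q = Q" by (auto simp: Q_def q power_add)
  have n2: "2 \<le> n" using n Q m by (cases "n = 0 \<or> n = 1") (auto simp: q power_add)
  have pf: "pfrac n = real n / 2 ^ c" by (rule pfrac_eq[OF n n2])
  define A where "A = n div 2 ^ m"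
  define B where "B = n div 2 ^ Suc m"
  have BA: "B = A div 2" by (simp add: A_def B_def div_mult2_eq mult.commute[of 2])
  have A: "A * 2 ^ m \<le> n" "n < (A + 1) * 2 ^ m" "A \<le> n"
    by (simp_all add: A_def dividend_less_div_times add.commute)
  have A4: "4 * Q \<le> A"
  proof -
    have "4 * Q * 2 ^ m < (A + 1) * 2 ^ m" using n(1) Q A by linarith
    then show ?thesis by (simp only: mult_less_cancel2) simp
  qed
  have A8: "A \<le> 8 * Q"
  proof -
    have "A * 2 ^ m \<le> 8 * Q * 2 ^ m" using n(2) Q A by linarith
    then show ?thesis by simp
  qed
  have even: "probe n (Suc (2 * m + 1)) = n - B"
    using probe_even[of m "pfrac n" n] by (simp add: probe_def B_def)
  have B2: "2 \<le> B" "B \<le> n" using A4 Q A BA by auto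
  have th: "threshold e c n m = 2 * A - B - 3 * 2 ^ (c - Suc m - e)"
    by (simp add: threshold_def A_def B_def)
  have "(g < n - n div 2 ^ Suc m \<longrightarrow>
      search_cost a ts (probe n) (Suc (Suc K)) (2 * m + 1) (n - n div 2 ^ m) + m
        \<le> c - e + (if n \<le> g + threshold e c n m then 1 else 0)) \<and> (n - n div 2 ^ Suc m \<le> g \<longrightarrow>
      search_cost a ts (probe n) (Suc (Suc K)) (2 * m + 1) (n - n div 2 ^ m)
        = 2 + search_cost a ts (probe n) K (2 * Suc m + 1) (n - n div 2 ^ Suc m))"
  proof (cases "3 * 2 ^ c < 4 * n")
    case True
    have e1: "e = 1" using e True by simp
    have "6 * Q * 2 ^ m < (A + 1) * 2 ^ m" using True Q A by linarith
    then have A6: "6 * Q \<le> A" by (simp only: mult_less_cancel2) simp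
    have "3/4 < pfrac n"
    proof -
      have "3 * 2 ^ c < 4 * real n" using of_nat_less_iff[where ?'a = real, THEN iffD2, OF True] by simp
      then show ?thesis unfolding pf by (simp add: field_simps)
    qed
    then have odd: "probe n (2 * m + 1) = n - A + 2 * Q"
      using probe_odd_high[OF q _ pf] n2 by (simp add: probe_def A_def Q_def)
    have C: "(2::nat) ^ Suc q = 2 * Q" by (simp add: Q_def)
    have th1: "threshold e c n m = 2 * A - B - 6 * Q" unfolding th by (simp add: e1 q Q_def)
    have bnds: "B + 2 * Q \<le> A" "A - B \<le> 4 * Q" "3 * Q \<le> A - B" using A6 A8 BA by linarith+
    have s1: "search_cost a ts (probe n) (Suc (Suc K)) (2 * m + 1) (n - A)
        = Suc (rhbs_gap_cost (Suc q) (2 * Q) (g - (n - A)))" if "g < n - A + 2 * Q"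
      using search_cost_stop[OF gap(1), of "n - A" "probe n" "2 * m + 1" "Suc q" "Suc K"] that lo bnds A B2 gap(2)
      unfolding odd C by (simp add: A_def[symmetric])
    have nx: "search_cost a ts (probe n) (Suc (Suc K)) (2 * m + 1) (n - A)
        = Suc (search_cost a ts (probe n) (Suc K) (Suc (2 * m + 1)) (n - A + 2 * Q))" if "n - A + 2 * Q \<le> g"
      using search_cost_next[OF gap(1), of "probe n" "2 * m + 1" "Suc K" "n - A"] that bnds A B2 gap(2) Q
      unfolding odd by simp
    have s2: "search_cost a ts (probe n) (Suc K) (Suc (2 * m + 1)) (n - A + 2 * Q)
        = Suc (rhbs_gap_cost (Suc q) (A - B - 2 * Q) (g - (n - A + 2 * Q)))"
      if "n - A + 2 * Q \<le> g" "g < n - B"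
    proof -
      have eq: "n - B - (n - A + 2 * Q) = A - B - 2 * Q" using A B2 bnds by linarith
      show ?thesis
        using search_cost_stop[OF gap(1), of "n - A + 2 * Q" "probe n" "Suc (2 * m + 1)" "Suc q" K] that bnds A B2 gap(2)
        unfolding even C eq by simp
    qed
    have nx2: "search_cost a ts (probe n) (Suc K) (Suc (2 * m + 1)) lo'
        = Suc (search_cost a ts (probe n) K (2 * Suc m + 1) (n - B))" if "n - B \<le> g" for lo'
      using search_cost_next[OF gap(1), of "probe n" "Suc (2 * m + 1)" K lo'] that bnds A B2 gap(2) Q
      unfolding even by simp
    have "search_cost a ts (probe n) (Suc (Suc K)) (2 * m + 1) (n - A) + m
        \<le> c - e + (if n \<le> g + threshold e c n m then 1 else 0)" if g: "g < n - B"
    proof (cases "g < n - A + 2 * Q")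
      case True
      \<comment> \<open>One probe and a perfect tree of depth \<open>q + 1\<close> make
        \<open>q + 2\<close>, which equals \<open>c - e - m\<close>.\<close>
      then show ?thesis using s1 by (simp add: rhbs_gap_cost_def q e1 Q)
    next
      case False
      then have g1: "n - A + 2 * Q \<le> g" by simp
      \<comment> \<open>The left side is the condition for a shallow leaf in the second piece;
        solved for \<open>g\<close> it is the threshold.\<close>
      have "g - (n - A + 2 * Q) + (A - B - 2 * Q) < 2 * Q \<longleftrightarrow> \<not> n \<le> g + threshold e c n m"
        unfolding th1 using g1 bnds A(3) B2 A6 by arith
      then show ?thesis using nx[OF g1] s2[OF g1 g]
        by (simp add: rhbs_gap_cost_def q e1 Q)
    qed
    moreover have "search_cost a ts (probe n) (Suc (Suc K)) (2 * m + 1) (n - A)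
        = 2 + search_cost a ts (probe n) K (2 * Suc m + 1) (n - B)" if "n - B \<le> g"
    proof -
      have "n - A + 2 * Q \<le> g" using that bnds A B2 by linarith
      then show ?thesis using nx nx2[OF that] by simp
    qed
    ultimately show ?thesis unfolding A_def[symmetric] B_def[symmetric] by blast
  next
    case False
    have e2: "e = 2" using e False by simp
    have "A * 2 ^ m \<le> 6 * Q * 2 ^ m" using False Q A by linarith
    then have A6: "A \<le> 6 * Q" by simp
    have "pfrac n \<le> 3/4"
    proof -
      have "4 * real n \<le> 3 * 2 ^ c" using of_nat_le_iff[where ?'a = real, THEN iffD2, OF False[unfolded not_less]] by simp
      then show ?thesis unfolding pf by (simp add: field_simps)
    qed
    then have odd: "probe n (2 * m + 1) = n - B - Q"
      using probe_odd_low[OF q _ pf] n2 by (simp add: probe_def B_def Q_def)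
    have C: "(2::nat) ^ Suc q = 2 * Q" by (simp add: Q_def)
    have th1: "threshold e c n m = 2 * A - B - 3 * Q" unfolding th by (simp add: e2 q Q_def)
    have bnds: "B + 2 * Q \<le> A" "A - B \<le> 3 * Q" using A4 A6 BA by linarith+
    have s1: "search_cost a ts (probe n) (Suc (Suc K)) (2 * m + 1) (n - A)
        = Suc (rhbs_gap_cost (Suc q) (A - B - Q) (g - (n - A)))" if "g < n - B - Q"
    proof -
      have eq: "n - B - Q - (n - A) = A - B - Q" using A B2 bnds by linarith
      show ?thesis
        using search_cost_stop[OF gap(1), of "n - A" "probe n" "2 * m + 1" "Suc q" "Suc K"] that lo bnds A B2 gap(2)
        unfolding odd C eq by (simp add: A_def[symmetric])
    qed
    have nx: "search_cost a ts (probe n) (Suc (Suc K)) (2 * m + 1) (n - A)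
        = Suc (search_cost a ts (probe n) (Suc K) (Suc (2 * m + 1)) (n - B - Q))" if "n - B - Q \<le> g"
      using search_cost_next[OF gap(1), of "probe n" "2 * m + 1" "Suc K" "n - A"] that bnds A B2 gap(2) Q
      unfolding odd by simp
    have s2: "search_cost a ts (probe n) (Suc K) (Suc (2 * m + 1)) (n - B - Q)
        = Suc (rhbs_gap_cost q Q (g - (n - B - Q)))"
      if "n - B - Q \<le> g" "g < n - B"
    proof -
      have eq: "n - B - (n - B - Q) = Q" using A B2 bnds by linarith
      show ?thesis
        using search_cost_stop[OF gap(1), of "n - B - Q" "probe n" "Suc (2 * m + 1)" q K] that bnds A B2 gap(2)
        unfolding even Q(3) eq by simp
    qed
    have nx2: "search_cost a ts (probe n) (Suc K) (Suc (2 * m + 1)) lo'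
        = Suc (search_cost a ts (probe n) K (2 * Suc m + 1) (n - B))" if "n - B \<le> g" for lo'
      using search_cost_next[OF gap(1), of "probe n" "Suc (2 * m + 1)" K lo'] that bnds A B2 gap(2) Q
      unfolding even by simp
    have "search_cost a ts (probe n) (Suc (Suc K)) (2 * m + 1) (n - A) + m
        \<le> c - e + (if n \<le> g + threshold e c n m then 1 else 0)" if g: "g < n - B"
    proof (cases "g < n - B - Q")
      case True
      have "g - (n - A) + (A - B - Q) < 2 * Q \<longleftrightarrow> \<not> n \<le> g + threshold e c n m"
        unfolding th1 using lo[folded A_def] bnds A(3) B2 by arith
      then show ?thesis using s1[OF True] by (simp add: rhbs_gap_cost_def q e2 Q)
    next
      case False
      then have g1: "n - B - Q \<le> g" by simp
      \<comment> \<open>The whole second piece lies beyond the threshold: two probes and depth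
        \<open>q\<close> exceed \<open>c - e - m = q + 1\<close> by one.\<close>
      have "n \<le> g + threshold e c n m"
        unfolding th1 using g1 bnds A(3) B2 by arith
      then show ?thesis using nx[OF g1] s2[OF g1 g]
        by (simp add: rhbs_gap_cost_def q e2 Q)
    qed
    moreover have "search_cost a ts (probe n) (Suc (Suc K)) (2 * m + 1) (n - A)
        = 2 + search_cost a ts (probe n) K (2 * Suc m + 1) (n - B)" if "n - B \<le> g"
    proof -
      have "n - B - Q \<le> g" using that bnds A B2 by linarith
      then show ?thesis using nx nx2[OF that] by simp
    qed
    ultimately show ?thesis unfolding A_def[symmetric] B_def[symmetric] by blast
  qed
  then show "g < n - n div 2 ^ Suc m \<Longrightarrow>
      search_cost a ts (probe n) (Suc (Suc K)) (2 * m + 1) (n - n div 2 ^ m) + m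
        \<le> c - e + (if n \<le> g + threshold e c n m then 1 else 0)"
    and "n - n div 2 ^ Suc m \<le> g \<Longrightarrow>
      search_cost a ts (probe n) (Suc (Suc K)) (2 * m + 1) (n - n div 2 ^ m)
        = 2 + search_cost a ts (probe n) K (2 * Suc m + 1) (n - n div 2 ^ Suc m)"
    by simp_all
qed

section \<open>Total insertion cost over all gaps\<close>

definition ceil_lg :: "nat \<Rightarrow> nat" where
  "ceil_lg N = (LEAST C. N \<le> 2 ^ C)"

lemma ceil_lg:
  assumes "1 \<le> N"
  shows "N \<le> 2 ^ ceil_lg N" "2 ^ ceil_lg N < 2 * N"
proof -
  have "N \<le> 2 ^ N" by (rule less_imp_le) (rule less_exp)
  then show "N \<le> 2 ^ ceil_lg N" unfolding ceil_lg_def by (rule LeastI)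
  show "2 ^ ceil_lg N < 2 * N"
  proof (cases "ceil_lg N")
    case 0
    then show ?thesis using assms by simp
  next
    case (Suc C)
    then have "\<not> N \<le> 2 ^ C" unfolding ceil_lg_def by (intro not_less_Least) simp
    then show ?thesis using Suc by simp
  qed
qed

lemma ceil_lg_unique:
  assumes "2 ^ c < 2 * n" "n \<le> 2 ^ c"
  shows "ceil_lg n = c"
proof -
  have *: "x \<le> y" if "2 ^ x < 2 * n" "n \<le> 2 ^ y" for x y
  proof (rule ccontr)
    assume "\<not> x \<le> y"
    then have "(2::nat) ^ Suc y \<le> 2 ^ x" by (intro power_increasing) auto
    then show False using that by simp
  qed
  have "1 \<le> n" using assms by (cases n) auto
  from *[OF ceil_lg(2)[OF this] assms(2)] *[OF assms(1) ceil_lg(1)[OF this]]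
  show ?thesis by simp
qed

definition insert_total :: "nat \<Rightarrow> real" where
  "insert_total N = (\<Sum>g<N. real (rhbs_gap_cost (ceil_lg N) N g))"

lemma insert_total_eq:
  assumes "1 \<le> N"
  shows "insert_total N = real N * (real (ceil_lg N) + 1) - 2 ^ ceil_lg N"
  unfolding insert_total_def by (rule rhbs_gap_cost_sum) (use ceil_lg[OF assms] in auto)

text \<open>Within an octave the closed form follows by adding the path length. The terms free of
  \<open>n\<close> are those that make the formulas for \<open>c\<close> and \<open>c + 1\<close>
  agree at \<open>n = 2 ^ c\<close>, and that give 0 at \<open>n = 1\<close>.\<close>

lemma sum_insert_total:
  assumes "1 \<le> n"
  shows "(\<Sum>N<n. insert_total N) = (real (ceil_lg n) + 1) * real n * (real n - 1) / 2
    - 2 ^ ceil_lg n * real n + (2 ^ ceil_lg n)\<^sup>2 / 6 + 2 ^ ceil_lg n / 2 + 1/3"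
  using assms
proof (induction n rule: dec_induct)
  case base
  have "ceil_lg 1 = 0" by (rule ceil_lg_unique) auto
  then show ?case by (simp add: insert_total_def)
next
  case (step n)
  define c where "c = ceil_lg n"
  define M :: real where "M = 2 ^ c"
  have b: "n \<le> 2 ^ c" "2 ^ c < 2 * n" using ceil_lg[OF step.hyps(1)] by (simp_all add: c_def)
  have it: "insert_total n = real n * (real c + 1) - M"
    using insert_total_eq[OF step.hyps(1)] by (simp add: c_def M_def)
  have IH: "(\<Sum>N<n. insert_total N) = (real c + 1) * real n * (real n - 1) / 2
    - M * real n + M\<^sup>2 / 6 + M / 2 + 1/3"
    using step.IH by (simp add: c_def M_def)
  show ?case
  proof (cases "n = 2 ^ c")
    case True
    have c': "ceil_lg (Suc n) = Suc c" by (rule ceil_lg_unique) (use True in auto)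
    have nM: "real n = M" by (simp add: True M_def)
    show ?thesis unfolding sum.lessThan_Suc IH it c' of_nat_Suc nM power_Suc M_def[symmetric]
      by (simp add: field_simps power2_eq_square)
  next
    case False
    have c': "ceil_lg (Suc n) = c" by (rule ceil_lg_unique) (use False b in auto)
    show ?thesis unfolding sum.lessThan_Suc IH it c' of_nat_Suc M_def[symmetric]
      by (simp add: field_simps power2_eq_square)
  qed
qed

section \<open>Ranks, gaps of sorted sets and sums over ranks\<close>

definition rank_in :: "nat set \<Rightarrow> nat \<Rightarrow> nat" where
  "rank_in S x = card {y \<in> S. y < x}"

lemma rank_in_less:
  assumes "finite S" "x \<in> S" "x < y"
  shows "rank_in S x < rank_in S y"
  unfolding rank_in_def using assms by (intro psubset_card_mono) auto

lemma rank_in_less_iff: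
  assumes "finite S" "x \<in> S" "y \<in> S"
  shows "rank_in S x < rank_in S y \<longleftrightarrow> x < y"
  using rank_in_less[OF assms(1,2), of y] rank_in_less[OF assms(1,3), of x] by (cases x y rule: linorder_cases) auto

lemma rank_in_bij:
  assumes "finite S"
  shows "bij_betw (rank_in S) S {..<card S}"
proof -
  have inj: "inj_on (rank_in S) S"
  proof (rule inj_onI)
    fix x y assume "x \<in> S" "y \<in> S" "rank_in S x = rank_in S y"
    then show "x = y" using rank_in_less[OF assms, of x y] rank_in_less[OF assms, of y x]
      by (cases x y rule: linorder_cases) auto
  qed
  have "rank_in S ` S \<subseteq> {..<card S}"
    using assms by (auto simp: rank_in_def intro!: psubset_card_mono)
  then have "rank_in S ` S = {..<card S}"
    by (intro card_subset_eq) (auto simp: card_image[OF inj])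
  with inj show ?thesis by (simp add: bij_betw_def)
qed

text \<open>Costs depend on elements only through their ranks; this turns sums over elements of an
  arbitrary set into sums over indices.\<close>

lemma sum_rank:
  assumes "finite S"
  shows "(\<Sum>x\<in>S. f (rank_in S x)) = (\<Sum>i<card S. f i)"
  by (rule sum.reindex_bij_betw[OF rank_in_bij[OF assms]])

lemma sum_rank_pairs:
  fixes f :: "nat \<Rightarrow> nat \<Rightarrow> real"
  assumes "finite S"
  shows "(\<Sum>a\<in>S. \<Sum>b\<in>{b\<in>S. a < b}. f (rank_in S a) (rank_in S b)) = (\<Sum>i<card S. \<Sum>j=Suc i..<card S. f i j)"
proof -
  have "(\<Sum>b\<in>{b\<in>S. a < b}. f (rank_in S a) (rank_in S b)) = (\<Sum>j=Suc (rank_in S a)..<card S. f (rank_in S a) j)"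
    if a: "a \<in> S" for a
  proof -
    have "(\<Sum>b\<in>{b\<in>S. a < b}. f (rank_in S a) (rank_in S b))
        = (\<Sum>b\<in>S. if rank_in S a < rank_in S b then f (rank_in S a) (rank_in S b) else 0)"
      using assms a by (subst sum.inter_filter) (auto simp: rank_in_less_iff intro!: sum.cong)
    also have "\<dots> = (\<Sum>j<card S. if rank_in S a < j then f (rank_in S a) j else 0)"
      by (rule sum_rank[OF assms])
    also have "\<dots> = (\<Sum>j\<in>{j\<in>{..<card S}. rank_in S a < j}. f (rank_in S a) j)"
      by (rule sum.inter_filter[symmetric]) simp
    also have "{j\<in>{..<card S}. rank_in S a < j} = {Suc (rank_in S a)..<card S}" by auto
    finally show ?thesis .
  qed
  then show ?thesis
    by (simp add: sum_rank[OF assms, of "\<lambda>i. \<Sum>j=Suc i..<card S. f i j"])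
qed

lemma gap_filter:
  assumes "sorted xs" "a \<notin> set xs"
  shows "gap a xs (length (filter (\<lambda>t. t < a) xs))"
  using assms
proof (induction xs)
  case Nil
  then show ?case by (simp add: gap_def)
next
  case (Cons x xs)
  then have IH: "gap a xs (length (filter (\<lambda>t. t < a) xs))" by simp
  show ?case
  proof (cases "x < a")
    case True
    have "(a < (x # xs) ! j) = (Suc (length (filter (\<lambda>t. t < a) xs)) \<le> j)" if "j < Suc (length xs)" for j
      using IH True that by (cases j) (auto simp: gap_def)
    then show ?thesis using True IH by (simp add: gap_def)
  next
    case False
    then have "\<forall>y\<in>set (x # xs). a < y" using Cons.prems by force
    then have "filter (\<lambda>t. t < a) (x # xs) = []" "\<forall>j<length (x # xs). a < (x # xs) ! j"
      by (force simp: filter_empty_conv, meson nth_mem)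
    then show ?thesis by (simp add: gap_def)
  qed
qed

lemma length_filter_sorted_list_of_set:
  assumes "finite T"
  shows "length (filter (\<lambda>t. t < a) (sorted_list_of_set T)) = rank_in T a"
proof -
  have "length (filter (\<lambda>t. t < a) (sorted_list_of_set T)) = card (set (filter (\<lambda>t. t < a) (sorted_list_of_set T)))"
    by (rule distinct_card[symmetric]) simp
  also have "set (filter (\<lambda>t. t < a) (sorted_list_of_set T)) = {y \<in> T. y < a}" using assms by auto
  finally show ?thesis by (simp add: rank_in_def)
qed

lemma gap_sorted_list_of_set:
  assumes "finite T" "a \<notin> T"
  shows "gap a (sorted_list_of_set T) (rank_in T a)"
  using gap_filter[of "sorted_list_of_set T" a] assms by (simp add: length_filter_sorted_list_of_set)

lemma rhbs_sorted_list_of_set: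
  assumes "finite T" "b \<notin> T" "l \<le> rank_in T b"
  shows "rhbs b (drop l (sorted_list_of_set T)) =
    rhbs_gap_cost (ceil_lg (Suc (card T) - l)) (Suc (card T) - l) (rank_in T b - l)"
proof -
  have "rank_in T b \<le> card T" unfolding rank_in_def using assms(1) by (intro card_mono) auto
  then have l: "Suc (card T - l) = Suc (card T) - l" "1 \<le> Suc (card T) - l" using assms(3) by auto
  show ?thesis
    using rhbs_cost[OF gap_drop[OF gap_sorted_list_of_set[OF assms(1,2)] assms(3)], of "ceil_lg (Suc (card T) - l)"]
      ceil_lg[OF l(2)] l(1) by simp
qed

section \<open>Recursion on the last two elements of a permutation\<close>

lemma sum_permutations_snoc:
  assumes "finite A" "A \<noteq> {}"
  shows "(\<Sum>s\<in>permutations_of_set A. f s) = (\<Sum>x\<in>A. \<Sum>s\<in>permutations_of_set (A - {x}). f (s @ [x]))"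
proof -
  have "(\<Sum>x\<in>A. \<Sum>s\<in>permutations_of_set (A - {x}). f (s @ [x]))
      = (\<Sum>(x, s)\<in>(SIGMA x:A. permutations_of_set (A - {x})). f (s @ [x]))"
    using assms by (subst sum.Sigma) auto
  also have "\<dots> = (\<Sum>s\<in>permutations_of_set A. f s)"
  proof (rule sum.reindex_bij_witness[where i = "\<lambda>s. (last s, butlast s)" and j = "\<lambda>(x, s). s @ [x]"])
    fix s assume s: "s \<in> permutations_of_set A"
    then obtain t x where t: "s = t @ [x]"
      using assms(2) by (cases s rule: rev_cases) (auto simp: permutations_of_set_def)
    show "(last s, butlast s) \<in> (SIGMA x:A. permutations_of_set (A - {x}))"
      using s unfolding t by (auto simp: permutations_of_set_def)
    show "(case (last s, butlast s) of (x, s) \<Rightarrow> s @ [x]) = s" unfolding t by simp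
  next
    fix p assume "p \<in> (SIGMA x:A. permutations_of_set (A - {x}))"
    then obtain x s where p: "p = (x, s)" "x \<in> A" "set s = A - {x}" "distinct s"
      by (auto simp: permutations_of_set_def)
    show "(last (case p of (x, s) \<Rightarrow> s @ [x]), butlast (case p of (x, s) \<Rightarrow> s @ [x])) = p"
      by (simp add: p)
    show "(case p of (x, s) \<Rightarrow> s @ [x]) \<in> permutations_of_set A"
      using p by (simp add: permutations_of_set_def insert_absorb)
    show "f (case p of (x, s) \<Rightarrow> s @ [x]) = (case p of (x, s) \<Rightarrow> f (s @ [x]))"
      by (simp add: p)
  qed
  finally show ?thesis by (rule sym)
qed

definition pair_cost :: "nat \<Rightarrow> nat \<Rightarrow> nat list \<Rightarrow> nat" where
  "pair_cost a b T = (if use_2merge (length T + 2) then twomerge a b T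
     else rhbs a T + rhbs b (insort a T))"

declare ins12.simps [simp del]

lemma ins12_snoc2:
  assumes "s \<noteq> []"
  shows "ins12 (s @ [a, b]) = ins12 s + pair_cost a b (sort s)"
proof -
  have n: "length (s @ [a, b]) = length s + 2" "\<not> length s + 2 \<le> 2" using assms by simp_all
  have nths: "(s @ [a, b]) ! (length s + 2 - 2) = a" "(s @ [a, b]) ! (length s + 2 - 1) = b"
    "take (length s + 2 - 2) (s @ [a, b]) = s"
    by (simp_all add: nth_append)
  show ?thesis
    by (subst ins12.simps) (simp only: Let_def n nths if_False pair_cost_def length_sort)
qed

text \<open>Defined for arbitrary finite sets, because removing the last two entries of a
  permutation of an initial segment leaves a set with holes.\<close>

definition total_cost :: "nat set \<Rightarrow> real" where
  "total_cost S = (\<Sum>s\<in>permutations_of_set S. real (ins12 s))"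

text \<open>The cost of inserting the last two elements sees only the sorted rest, so it is the same
  for all \<open>fact m\<close> orderings of that rest.\<close>

lemma total_cost_rec:
  assumes "finite S" "card S = m + 2" "0 < m"
  shows "total_cost S = (\<Sum>b\<in>S. \<Sum>a\<in>S - {b}. total_cost (S - {b} - {a})
    + fact m * real (pair_cost a b (sorted_list_of_set (S - {b} - {a}))))"
proof -
  have inner: "(\<Sum>s\<in>permutations_of_set (S - {b} - {a}). real (ins12 (s @ [a, b])))
     = total_cost (S - {b} - {a}) + fact m * real (pair_cost a b (sorted_list_of_set (S - {b} - {a})))"
    if "b \<in> S" "a \<in> S - {b}" for a b
  proof -
    define T where "T = S - {b} - {a}"
    have T: "finite T" "card T = m" using assms that by (auto simp: T_def)
    have "real (ins12 (s @ [a, b])) = real (ins12 s) + real (pair_cost a b (sorted_list_of_set T))"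
      if "s \<in> permutations_of_set T" for s
    proof -
      have s: "set s = T" "distinct s" using that by (auto simp: permutations_of_set_def)
      then have "s \<noteq> []" using T assms(3) by auto
      moreover have "sort s = sorted_list_of_set T"
        using s by (metis sorted_list_of_set_sort_remdups distinct_remdups_id)
      ultimately show ?thesis by (simp add: ins12_snoc2)
    qed
    then have "(\<Sum>s\<in>permutations_of_set T. real (ins12 (s @ [a, b])))
       = total_cost T + (\<Sum>s\<in>permutations_of_set T. real (pair_cost a b (sorted_list_of_set T)))"
      by (simp add: total_cost_def sum.distrib)
    also have "\<dots> = total_cost T + fact m * real (pair_cost a b (sorted_list_of_set T))"
      using T by simp
    finally show ?thesis by (simp only: T_def)
  qed
  have ne: "S \<noteq> {}" "S - {b} \<noteq> {}" if "b \<in> S" for b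
  proof -
    show "S \<noteq> {}" using that by auto
    have "card (S - {b}) = m + 1" using that assms by simp
    then show "S - {b} \<noteq> {}" by (metis Suc_eq_plus1 card.empty nat.distinct(1))
  qed
  have "S \<noteq> {}" using assms by auto
  have "total_cost S = (\<Sum>b\<in>S. \<Sum>a\<in>S - {b}. \<Sum>s\<in>permutations_of_set (S - {b} - {a}). real (ins12 ((s @ [a]) @ [b])))"
    unfolding total_cost_def sum_permutations_snoc[OF assms(1) \<open>S \<noteq> {}\<close>]
    by (intro sum.cong refl sum_permutations_snoc) (use assms ne in auto)
  then show ?thesis using inner by simp
qed

section \<open>2Merge* summed over all pairs of ranks\<close>

lemma twomerge_eq:
  "twomerge a0 b0 ts = 1 + search_cost (min a0 b0) ts (probe (length ts + 2))
     (nat \<lfloor>2 * log 2 (real (length ts + 2))\<rfloor>) 1 0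
   + rhbs (max a0 b0) (drop (length (filter (\<lambda>t. t < min a0 b0) ts)) ts)"
  unfolding twomerge_def search_cost_def probe_def Let_def by (simp split: prod.splits)

text \<open>The lower bound says that the permitted probes suffice for all \<open>c - 2\<close>
  stages, the upper bound feeds the crude estimate for the last gaps.\<close>

lemma probe_count_bounds:
  assumes "2 ^ c < 2 * n" "2 \<le> n"
  shows "2 * (c - 2) \<le> nat \<lfloor>2 * log 2 (real n)\<rfloor>" "nat \<lfloor>2 * log 2 (real n)\<rfloor> \<le> 2 * n"
proof -
  have "real c - 1 \<le> log 2 (real n)"
  proof -
    have "real (2 ^ c) \<le> real (2 * n)" using assms by (intro of_nat_mono) simp
    then have "2 powr real c \<le> 2 * real n" by (simp add: powr_realpow)
    then have "real c \<le> log 2 (2 * real n)" using assms by (simp add: le_log_iff)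
    also have "\<dots> = 1 + log 2 (real n)" using assms by (simp add: log_mult)
    finally show ?thesis by simp
  qed
  moreover have "0 \<le> log 2 (real n)" using assms by simp
  ultimately have "real_of_int (int (2 * (c - 2))) \<le> 2 * log 2 (real n)"
    by (cases "2 \<le> c") simp_all
  then have "int (2 * (c - 2)) \<le> \<lfloor>2 * log 2 (real n)\<rfloor>" by (simp only: le_floor_iff)
  then show "2 * (c - 2) \<le> nat \<lfloor>2 * log 2 (real n)\<rfloor>" by simp
  have "real n \<le> real (2 ^ n)" by (rule of_nat_mono) (simp add: less_imp_le)
  then have "log 2 (real n) \<le> real n" using assms by (simp add: log_le_iff powr_realpow)
  then have "2 * log 2 (real n) < of_int (int (2 * n)) + 1" by simp
  then have "\<lfloor>2 * log 2 (real n)\<rfloor> \<le> int (2 * n)" by (simp only: floor_le_iff)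
  then show "nat \<lfloor>2 * log 2 (real n)\<rfloor> \<le> 2 * n" by simp
qed

text \<open>\<open>N\<close> is the number of elements above the smaller one,
  \<open>n - 1 - g\<close> for gap \<open>g\<close>; in this variable \<open>n \<le> g + x\<close>
  becomes \<open>N < x\<close>.\<close>

definition search_bound :: "nat \<Rightarrow> nat \<Rightarrow> nat \<Rightarrow> nat \<Rightarrow> nat" where
  "search_bound e c n N = c - e + (\<Sum>k<c - 2. if N < threshold e c n k then 1 else 0)
     + (if N < 4 then 3 * n else 0)"

text \<open>Without \<open>a\<close> and \<open>b\<close>, the rank of \<open>a\<close> is unchanged
  and that of \<open>b\<close> drops by one. Past \<open>a\<close> there remain
  \<open>n - 2 - g\<close> elements, hence \<open>n - 1 - g\<close> gaps for
  \<open>b\<close>.\<close>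

lemma twomerge_le:
  assumes S: "finite S" "card S = n" "4 \<le> n" and n: "2 ^ c < 2 * n" "n \<le> 2 ^ c"
    and e: "e = (if 3 * 2 ^ c < 4 * n then 1 else 2)"
    and ab: "a \<in> S" "b \<in> S" "a < b" and ab0: "min a0 b0 = a" "max a0 b0 = b"
  shows "twomerge a0 b0 (sorted_list_of_set (S - {a, b})) \<le>
    1 + search_bound e c n (n - 1 - rank_in S a)
      + rhbs_gap_cost (ceil_lg (n - 1 - rank_in S a)) (n - 1 - rank_in S a) (rank_in S b - Suc (rank_in S a))"
proof -
  define T where "T = S - {a, b}"
  define g where "g = rank_in S a"
  define ts where "ts = sorted_list_of_set T"
  have T: "finite T" "a \<notin> T" "b \<notin> T" "card T = n - 2"
    using S ab by (auto simp: T_def card_Diff_subset)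
  have "{y \<in> T. y < a} = {y \<in> S. y < a}" using ab by (auto simp: T_def)
  then have ra: "rank_in T a = g" by (simp add: rank_in_def g_def)
  have "{y \<in> T. y < b} = {y \<in> S. y < b} - {a}" using ab by (auto simp: T_def)
  then have rb: "rank_in T b = rank_in S b - 1" using ab S by (simp add: rank_in_def)
  have gl: "g < rank_in S b" unfolding g_def using rank_in_less[OF S(1) ab(1,3)] .
  have rbn: "rank_in S b < n" using rank_in_bij[OF S(1)] ab(2) S(2) by (auto dest: bij_betwE)
  have len: "length ts = n - 2" "length ts + 2 = n" using T S by (simp_all add: ts_def)
  have gap: "gap a ts g" using gap_sorted_list_of_set[OF T(1,2)] ra by (simp add: ts_def)
  have c: "2 \<le> c"
  proof (rule ccontr)
    assume "\<not> 2 \<le> c"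
    then have "(2::nat) ^ c \<le> 2 ^ 1" by (intro power_increasing) auto
    then show False using n S by simp
  qed
  have iff: "n \<le> g + x \<longleftrightarrow> n - 1 - g < x" for x using gl rbn by auto
  have "search_cost a ts (probe n) (nat \<lfloor>2 * log 2 (real n)\<rfloor>) 1 0
    \<le> c - e + (\<Sum>k<c - 2. if n \<le> g + threshold e c n k then 1 else 0) + (if n \<le> g + 4 then 3 * n else 0)"
  proof (rule search_cost_bound)
    show "length ts \<le> n" using len by simp
    show "2 * (c - 2) \<le> nat \<lfloor>2 * log 2 (real n)\<rfloor>" "nat \<lfloor>2 * log 2 (real n)\<rfloor> \<le> 2 * n"
      using probe_count_bounds[OF n(1)] S by simp_all
    show "2 \<le> c" "n \<le> 2 ^ c" by fact+
    show "n div 2 ^ Suc m \<le> threshold e c n m" if "m + 3 \<le> c" for m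
      by (rule threshold_ge[OF n(1) that e])
  qed (use stage_search[OF n _ e gap len(1)] in blast)+
  then have sc: "search_cost a ts (probe n) (nat \<lfloor>2 * log 2 (real n)\<rfloor>) 1 0 \<le> search_bound e c n (n - 1 - g)"
    unfolding search_bound_def iff .
  have "rhbs b (drop g ts) = rhbs_gap_cost (ceil_lg (Suc (n - 2) - g)) (Suc (n - 2) - g) (rank_in S b - 1 - g)"
    using rhbs_sorted_list_of_set[OF T(1,3), of g] gl rb T by (simp add: ts_def)
  also have "Suc (n - 2) - g = n - 1 - g" using S by simp
  also have "rank_in S b - 1 - g = rank_in S b - Suc g" by simp
  finally have rh: "rhbs b (drop g ts) = rhbs_gap_cost (ceil_lg (n - 1 - g)) (n - 1 - g) (rank_in S b - Suc g)" .
  have fl: "length (filter (\<lambda>t. t < a) ts) = g"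
    using length_filter_sorted_list_of_set[OF T(1), of a] ra by (simp add: ts_def)
  show ?thesis
    using twomerge_eq[of a0 b0 ts] sc unfolding ab0 fl len(2) rh
    by (simp add: ts_def T_def g_def)
qed

lemma sum_ordered_pairs:
  fixes f :: "nat \<Rightarrow> nat \<Rightarrow> real"
  assumes "finite S"
  shows "(\<Sum>b\<in>S. \<Sum>a\<in>S - {b}. f a b) = (\<Sum>a\<in>S. \<Sum>b\<in>{b\<in>S. a < b}. f a b + f b a)"
proof -
  have "(\<Sum>a\<in>S - {b}. f a b) = (\<Sum>a\<in>S. if a < b then f a b else 0) + (\<Sum>a\<in>S. if b < a then f a b else 0)"
    if "b \<in> S" for b
  proof -
    have "S - {b} = {a\<in>S. a < b} \<union> {a\<in>S. b < a}" by auto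
    then show ?thesis
      using assms by (simp add: sum.union_disjoint sum.inter_filter disjoint_iff)
  qed
  then have "(\<Sum>b\<in>S. \<Sum>a\<in>S - {b}. f a b) =
      (\<Sum>b\<in>S. \<Sum>a\<in>S. if a < b then f a b else 0) + (\<Sum>b\<in>S. \<Sum>a\<in>S. if b < a then f a b else 0)"
    by (simp add: sum.distrib)
  also have "(\<Sum>b\<in>S. \<Sum>a\<in>S. if a < b then f a b else 0) = (\<Sum>a\<in>S. \<Sum>b\<in>S. if a < b then f a b else 0)"
    by (rule sum.swap)
  also have "(\<Sum>a\<in>S. \<Sum>b\<in>S. if a < b then f a b else 0) + (\<Sum>b\<in>S. \<Sum>a\<in>S. if b < a then f a b else 0)
      = (\<Sum>a\<in>S. \<Sum>b\<in>{b\<in>S. a < b}. f a b + f b a)"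
    using assms by (simp add: sum.inter_filter[symmetric] sum.distrib)
  finally show ?thesis .
qed

text \<open>If \<open>N\<close> elements lie above the smaller one, there are \<open>N\<close>
  partners, and they hit each of the \<open>N\<close> remaining gaps once, which gives
  \<open>insert_total N\<close>. The factor 2 accounts for the two orders of the pair.\<close>

lemma sum_twomerge_le:
  assumes S: "finite S" "card S = n" "4 \<le> n" and n: "2 ^ c < 2 * n" "n \<le> 2 ^ c"
    and e: "e = (if 3 * 2 ^ c < 4 * n then 1 else 2)"
  shows "(\<Sum>b\<in>S. \<Sum>a\<in>S - {b}. real (twomerge a b (sorted_list_of_set (S - {b} - {a}))))
    \<le> 2 * (\<Sum>N<n. real N * (1 + real (search_bound e c n N)) + insert_total N)"
proof -
  define h where "h i j = 1 + real (search_bound e c n (n - 1 - i))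
      + real (rhbs_gap_cost (ceil_lg (n - 1 - i)) (n - 1 - i) (j - Suc i))" for i j
  have "(\<Sum>b\<in>S. \<Sum>a\<in>S - {b}. real (twomerge a b (sorted_list_of_set (S - {b} - {a}))))
    = (\<Sum>a\<in>S. \<Sum>b\<in>{b\<in>S. a < b}. real (twomerge a b (sorted_list_of_set (S - {b} - {a})))
        + real (twomerge b a (sorted_list_of_set (S - {a} - {b}))))"
    by (rule sum_ordered_pairs[OF S(1)])
  also have "\<dots> \<le> (\<Sum>a\<in>S. \<Sum>b\<in>{b\<in>S. a < b}. 2 * h (rank_in S a) (rank_in S b))"
  proof (intro sum_mono)
    fix a b assume a: "a \<in> S" and "b \<in> {b\<in>S. a < b}"
    then have b: "b \<in> S" "a < b" by auto
    have s: "S - {b} - {a} = S - {a, b}" "S - {a} - {b} = S - {a, b}" by auto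
    have h: "real x \<le> h (rank_in S a) (rank_in S b)" if
      "x \<le> 1 + search_bound e c n (n - 1 - rank_in S a)
        + rhbs_gap_cost (ceil_lg (n - 1 - rank_in S a)) (n - 1 - rank_in S a) (rank_in S b - Suc (rank_in S a))" for x
      using of_nat_mono[OF that, where ?'a = real] by (simp add: h_def)
    have "real (twomerge a b (sorted_list_of_set (S - {a, b}))) \<le> h (rank_in S a) (rank_in S b)"
      by (rule h, rule twomerge_le[OF S n e a b]) (use b in auto)
    moreover have "real (twomerge b a (sorted_list_of_set (S - {a, b}))) \<le> h (rank_in S a) (rank_in S b)"
      by (rule h, rule twomerge_le[OF S n e a b]) (use b in auto)
    ultimately show "real (twomerge a b (sorted_list_of_set (S - {b} - {a})))
        + real (twomerge b a (sorted_list_of_set (S - {a} - {b}))) \<le> 2 * h (rank_in S a) (rank_in S b)"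
      unfolding s by simp
  qed
  also have "\<dots> = 2 * (\<Sum>i<n. \<Sum>j=Suc i..<n. h i j)"
    using sum_rank_pairs[OF S(1), of "\<lambda>i j. 2 * h i j"] S(2) by (simp add: sum_distrib_left)
  also have "(\<Sum>i<n. \<Sum>j=Suc i..<n. h i j)
    = (\<Sum>i<n. real (n - Suc i) * (1 + real (search_bound e c n (n - Suc i))) + insert_total (n - Suc i))"
  proof (intro sum.cong refl)
    fix i assume i: "i \<in> {..<n}"
    have "(\<Sum>j=Suc i..<n. real (rhbs_gap_cost (ceil_lg (n - Suc i)) (n - Suc i) (j - Suc i))) = insert_total (n - Suc i)"
      unfolding insert_total_def
      by (rule sum.reindex_bij_witness[where i = "\<lambda>k. k + Suc i" and j = "\<lambda>j. j - Suc i"]) (use i in auto)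
    then show "(\<Sum>j=Suc i..<n. h i j)
      = real (n - Suc i) * (1 + real (search_bound e c n (n - Suc i))) + insert_total (n - Suc i)"
      by (simp add: h_def sum.distrib algebra_simps)
  qed
  also have "\<dots> = (\<Sum>N<n. real N * (1 + real (search_bound e c n N)) + insert_total N)"
    by (rule sum.nat_diff_reindex)
  finally show ?thesis .
qed

lemma sum_below: "(\<Sum>N<n. real N) = real n * (real n - 1) / 2"
  by (induction n) (auto simp: field_simps)

lemma sum_indicator_le:
  "(\<Sum>N<n. real N * (if N < z then 1 else 0)) \<le> real z * (real z - 1) / 2"
proof -
  have "(\<Sum>N<n. real N * (if N < z then 1 else 0)) = (\<Sum>N\<in>{N\<in>{..<n}. N < z}. real N)"
    by (subst sum.inter_filter) (auto intro!: sum.cong)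
  also have "\<dots> \<le> (\<Sum>N<z. real N)" by (rule sum_mono2) auto
  finally show ?thesis by (simp add: sum_below)
qed

text \<open>The constant 18 is \<open>3 * (0 + 1 + 2 + 3)\<close>, the crude charge over the cases
  \<open>N < 4\<close>.\<close>

lemma sum_search_bound_le:
  "(\<Sum>N<n. real N * real (search_bound e c n N)) \<le> real (c - e) * (real n * (real n - 1) / 2)
    + (\<Sum>k<c - 2. real (threshold e c n k) * (real (threshold e c n k) - 1) / 2) + 18 * real n"
proof -
  have "(\<Sum>N<n. real N * real (search_bound e c n N)) =
    (\<Sum>N<n. real (c - e) * real N) + (\<Sum>N<n. \<Sum>k<c - 2. real N * (if N < threshold e c n k then 1 else 0))
      + (\<Sum>N<n. 3 * real n * (real N * (if N < 4 then 1 else 0)))"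
    unfolding sum.distrib[symmetric]
    by (intro sum.cong refl) (auto simp: search_bound_def algebra_simps sum_distrib_left if_distrib cong: if_cong)
  also have "(\<Sum>N<n. \<Sum>k<c - 2. real N * (if N < threshold e c n k then 1 else 0))
    = (\<Sum>k<c - 2. \<Sum>N<n. real N * (if N < threshold e c n k then 1 else 0))" by (rule sum.swap)
  also have "\<dots> \<le> (\<Sum>k<c - 2. real (threshold e c n k) * (real (threshold e c n k) - 1) / 2)"
    by (intro sum_mono sum_indicator_le)
  also have "(\<Sum>N<n. 3 * real n * (real N * (if N < 4 then 1 else 0))) \<le> 3 * real n * 6"
    unfolding sum_distrib_left[symmetric] using sum_indicator_le[where n = n and z = 4]
    by (intro mult_left_mono) auto
  finally show ?thesis by (simp add: sum_distrib_left[symmetric] sum_below)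
qed

text \<open>Dropping the roundings gives \<open>3 * X / 2 ^ Suc m\<close> exactly; the first floor
  only helps, and the second, subtracted one costs at most 1.\<close>

lemma threshold_le:
  assumes "m < c - 2" "e \<le> 2" and X: "X = real n - 2 ^ c / 2 ^ e" "0 \<le> X"
  shows "real (threshold e c n m) \<le> 3 * X / 2 ^ Suc m + 1"
proof -
  have A: "real (n div 2 ^ m) \<le> real n / 2 ^ m"
    using of_nat_div_le_of_nat[of n "2 ^ m", where ?'a = real] by simp
  have B: "real n / 2 ^ Suc m - 1 \<le> real (n div 2 ^ Suc m)"
    using real_of_int_div3[of "int n" "int (2 ^ Suc m)"] unfolding zdiv_int[symmetric] by simp
  have P: "(2::real) ^ (c - Suc m - e) = 2 ^ c / 2 ^ e / 2 ^ Suc m"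
  proof -
    have "(2::real) ^ c = 2 ^ (c - Suc m - e) * 2 ^ e * 2 ^ Suc m"
      unfolding power_add[symmetric] using assms(1,2) by (intro arg_cong[where f = "power 2"]) simp
    then show ?thesis by simp
  qed
  have nn: "0 \<le> 3 * X / 2 ^ Suc m + 1" using X by simp
  show ?thesis
  proof (cases "threshold e c n m = 0")
    case False
    then have "threshold e c n m + n div 2 ^ Suc m + 3 * 2 ^ (c - Suc m - e) = 2 * (n div 2 ^ m)"
      by (simp add: threshold_def)
    then have "real (threshold e c n m + n div 2 ^ Suc m + 3 * 2 ^ (c - Suc m - e)) = real (2 * (n div 2 ^ m))"
      by (rule arg_cong)
    then have "real (threshold e c n m) + real (n div 2 ^ Suc m) + 3 * (2 ^ c / 2 ^ e / 2 ^ Suc m) = 2 * real (n div 2 ^ m)"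
      by (simp only: of_nat_add of_nat_mult of_nat_numeral of_nat_power P)
    then have "real (threshold e c n m) \<le> 2 * (real n / 2 ^ m) - (real n / 2 ^ Suc m - 1) - 3 * (2 ^ c / 2 ^ e / 2 ^ Suc m)"
      using A B by linarith
    also have "\<dots> = 3 * X / 2 ^ Suc m + 1" unfolding X by (simp add: field_simps)
    finally show ?thesis .
  qed (use nn in simp)
qed

text \<open>Squared thresholds form a geometric series of ratio \<open>1/4\<close>, the linear error
  terms one of ratio \<open>1/2\<close>.\<close>

lemma sum_threshold_le:
  assumes "e \<le> 2" and X: "X = real n - 2 ^ c / 2 ^ e" "0 \<le> X"
  shows "(\<Sum>k<c - 2. real (threshold e c n k) * (real (threshold e c n k) - 1) / 2) \<le> (3 * X\<^sup>2 + 3 * X) / 2"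
proof -
  have "(\<Sum>k<c - 2. real (threshold e c n k) * (real (threshold e c n k) - 1) / 2)
      \<le> (\<Sum>k<c - 2. (9 * X\<^sup>2 / 2) * (1 / 4 ^ Suc k) + (3 * X / 2) * (1 / 2 ^ Suc k))"
  proof (intro sum_mono)
    fix k assume "k \<in> {..<c - 2}"
    then have k: "k < c - 2" by simp
    define y where "y = 3 * X / 2 ^ Suc k"
    define z where "z = real (threshold e c n k)"
    have zy: "z \<le> y + 1" unfolding z_def y_def by (rule threshold_le[OF k assms])
    have y0: "0 \<le> y" using X by (simp add: y_def)
    have "z * (z - 1) \<le> (y + 1) * y"
    proof (cases "1 \<le> z")
      case True
      then show ?thesis using zy y0 by (intro mult_mono) auto
    next
      case False
      then have "z * (z - 1) \<le> 0" by (intro mult_nonneg_nonpos) (auto simp: z_def)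
      then show ?thesis using y0 by (intro order_trans[OF _ mult_nonneg_nonneg]) auto
    qed
    also have "(y + 1) * y = 9 * X\<^sup>2 * (1 / 4 ^ Suc k) + 3 * X * (1 / 2 ^ Suc k)"
    proof -
      have "(4::real) ^ Suc k = 2 ^ Suc k * 2 ^ Suc k" by (simp add: power_mult_distrib[symmetric])
      then show ?thesis by (simp add: y_def field_simps power2_eq_square)
    qed
    finally show "real (threshold e c n k) * (real (threshold e c n k) - 1) / 2
      \<le> (9 * X\<^sup>2 / 2) * (1 / 4 ^ Suc k) + (3 * X / 2) * (1 / 2 ^ Suc k)" by (simp add: z_def)
  qed
  also have "\<dots> = (9 * X\<^sup>2 / 2) * (\<Sum>k<c - 2. 1 / 4 ^ Suc k) + (3 * X / 2) * (\<Sum>k<c - 2. 1 / 2 ^ Suc k)"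
    by (simp add: sum.distrib sum_distrib_left)
  also have "\<dots> \<le> (9 * X\<^sup>2 / 2) * (1 / 3) + (3 * X / 2) * 1"
  proof -
    have "(\<Sum>k<j. 1 / (4::real) ^ Suc k) = (1 - 1 / 4 ^ j) / 3" for j
      by (induction j) (simp, simp only: sum.lessThan_Suc, simp add: field_simps)
    moreover have "(\<Sum>k<j. 1 / (2::real) ^ Suc k) = 1 - 1 / 2 ^ j" for j
      by (induction j) (simp, simp only: sum.lessThan_Suc, simp add: field_simps)
    ultimately show ?thesis using X by (intro add_mono mult_left_mono) auto
  qed
  finally show ?thesis by simp
qed

section \<open>Average cost of inserting one pair\<close>

text \<open>With \<open>p = n / 2 ^ c\<close>, this is the limiting amount by which the average cost of the pair insertion
  chosen by the algorithm differs from that of two separate binary insertions.\<close>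

definition gain :: "real \<Rightarrow> real" where
  "gain p = min 0 (1 - 3 / (2 * p) + 25 / (48 * p\<^sup>2) + (max 0 (1 - 3 / (4 * p)))\<^sup>2)"

text \<open>In this form the left root \<open>3/4 - sqrt 6 / 12\<close>, the lower end of
  \<open>use_2merge\<close>, is visible: \<open>(sqrt 6 / 12)\<^sup>2\<close> is
  \<open>1/24\<close>.\<close>

lemma gain_low:
  assumes "0 < p" "p \<le> 3/4"
  shows "gain p = min 0 (((p - 3/4)\<^sup>2 - 1/24) / p\<^sup>2)"
proof -
  have "1 - 3 / (4 * p) \<le> 0" using assms by (simp add: field_simps)
  then have "(max 0 (1 - 3 / (4 * p)))\<^sup>2 = 0" by (simp add: max_def)
  moreover have "1 - 3 / (2 * p) + 25 / (48 * p\<^sup>2) = ((p - 3/4)\<^sup>2 - 1/24) / p\<^sup>2"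
    using assms by (simp add: field_simps power2_eq_square)
  ultimately show ?thesis by (simp add: gain_def)
qed

text \<open>The right root is \<open>3/4 + sqrt 3 / 12\<close>, the upper end of
  \<open>use_2merge\<close>, as \<open>(sqrt 3 / 12)\<^sup>2\<close> is \<open>1/48\<close>.\<close>

lemma gain_high:
  assumes "3/4 \<le> p"
  shows "gain p = min 0 (2 * ((p - 3/4)\<^sup>2 - 1/48) / p\<^sup>2)"
proof -
  have "1 - 3 / (4 * p) \<ge> 0" using assms by (simp add: field_simps)
  then have "(max 0 (1 - 3 / (4 * p)))\<^sup>2 = (1 - 3 / (4 * p))\<^sup>2" by (simp add: max_def)
  moreover have "1 - 3 / (2 * p) + 25 / (48 * p\<^sup>2) + (1 - 3 / (4 * p))\<^sup>2 = 2 * ((p - 3/4)\<^sup>2 - 1/48) / p\<^sup>2"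
    using assms by (simp add: field_simps power2_eq_square)
  ultimately show ?thesis by (simp add: gain_def)
qed

text \<open>The form in which the gain arises from the counts: the square from the thresholds,
  \<open>1 / (3 * p\<^sup>2)\<close> from the insertion of the larger element, and
  \<open>- real e\<close> from the base cost \<open>c - e\<close>.\<close>

lemma gain_use_2merge:
  assumes p: "p = pfrac n" "0 < p" and u: "use_2merge n"
    and e: "e = (if 3/4 < p then 1 else 2)"
  shows "gain p = 3 * (1 - 1 / (2 ^ e * p))\<^sup>2 + 1 / (3 * p\<^sup>2) - real e"
proof (cases "3/4 < p")
  case True
  have "0 \<le> p - 3/4" "p - 3/4 \<le> sqrt 3 / 12" using u True p by (auto simp: use_2merge_def)
  then have "(p - 3/4)\<^sup>2 \<le> (sqrt 3 / 12)\<^sup>2" by (intro power_mono) auto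
  then have "(p - 3/4)\<^sup>2 - 1/48 \<le> 0" by (simp add: power_divide)
  then have "2 * ((p - 3/4)\<^sup>2 - 1/48) / p\<^sup>2 \<le> 0" by (intro divide_nonpos_nonneg) auto
  then have "gain p = 2 * ((p - 3/4)\<^sup>2 - 1/48) / p\<^sup>2"
    unfolding gain_high[OF less_imp_le[OF True]] by (rule min_absorb2)
  also have "\<dots> = 3 * (1 - 1 / (2 ^ 1 * p))\<^sup>2 + 1 / (3 * p\<^sup>2) - real 1"
    using p(2) by (simp add: field_simps power2_eq_square)
  finally show ?thesis using True e by simp
next
  case False
  have "0 \<le> 3/4 - p" "3/4 - p \<le> sqrt 6 / 12" using u False p by (auto simp: use_2merge_def)
  then have "(3/4 - p)\<^sup>2 \<le> (sqrt 6 / 12)\<^sup>2" by (intro power_mono) auto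
  then have "(p - 3/4)\<^sup>2 - 1/24 \<le> 0" by (simp add: power_divide power2_commute)
  then have "((p - 3/4)\<^sup>2 - 1/24) / p\<^sup>2 \<le> 0" by (intro divide_nonpos_nonneg) auto
  then have "gain p = ((p - 3/4)\<^sup>2 - 1/24) / p\<^sup>2"
    using gain_low[OF p(2)] False by (simp add: min_absorb2)
  also have "\<dots> = 3 * (1 - 1 / (2 ^ 2 * p))\<^sup>2 + 1 / (3 * p\<^sup>2) - real 2"
    using p(2) by (simp add: field_simps power2_eq_square)
  finally show ?thesis using False e by simp
qed

lemma gain_not_use_2merge:
  assumes p: "p = pfrac n" "0 < p" and u: "\<not> use_2merge n"
  shows "gain p = 0"
proof (cases "3/4 < p")
  case True
  have "0 \<le> sqrt 6 / 12" by simp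
  then have "\<not> 3/4 - sqrt 6 / 12 > p" using True by linarith
  then have "sqrt 3 / 12 \<le> p - 3/4" using u p by (auto simp: use_2merge_def)
  then have "(sqrt 3 / 12)\<^sup>2 \<le> (p - 3/4)\<^sup>2" by (intro power_mono) auto
  then have "0 \<le> (p - 3/4)\<^sup>2 - 1/48" by (simp add: power_divide)
  then show ?thesis unfolding gain_high[OF less_imp_le[OF True]] by simp
next
  case False
  have "0 \<le> sqrt 3 / 12" by simp
  then have "p \<le> 3/4 + sqrt 3 / 12" using False by linarith
  then have "sqrt 6 / 12 \<le> 3/4 - p" using u p by (auto simp: use_2merge_def)
  then have "(sqrt 6 / 12)\<^sup>2 \<le> (3/4 - p)\<^sup>2" by (intro power_mono) auto
  then have "0 \<le> (p - 3/4)\<^sup>2 - 1/24" by (simp add: power_divide power2_commute)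
  then show ?thesis using gain_low[OF p(2)] False by simp
qed

lemma sum_two_insertions:
  assumes S: "finite S" "card S = n" "4 \<le> n" and n: "2 ^ c < 2 * n" "n \<le> 2 ^ c"
  shows "(\<Sum>b\<in>S. \<Sum>a\<in>S - {b}. real (rhbs a (sorted_list_of_set (S - {b} - {a}))
      + rhbs b (insort a (sorted_list_of_set (S - {b} - {a})))))
    = 2 * (real c + 1) * real n * (real n - 1) - 2 ^ c * (2 * real n - 1)"
proof -
  have c0: "c \<noteq> 0" using n S by (cases c) auto
  \<comment> \<open>Both sides of \<open>2 ^ c < 2 * n\<close> are even, so one may step down to
    \<open>n - 1\<close> and use the same exponent for both insertions.\<close>
  have n1: "2 ^ c \<le> 2 * (n - 1)" using n S c0 by (cases c) auto
  have first: "(\<Sum>a\<in>S - {b}. real (rhbs a (sorted_list_of_set (S - {b} - {a}))))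
      = real (n - 1) * (real c + 1) - 2 ^ c" if b: "b \<in> S" for b
  proof -
    have cd: "finite (S - {b})" "card (S - {b}) = n - 1" using S b by auto
    have "rhbs a (sorted_list_of_set (S - {b} - {a})) = rhbs_gap_cost c (n - 1) (rank_in (S - {b}) a)"
      if a: "a \<in> S - {b}" for a
    proof -
      have T: "finite (S - {b} - {a})" "a \<notin> S - {b} - {a}" "card (S - {b} - {a}) = n - 2"
        using cd a by auto
      have "{y \<in> S - {b} - {a}. y < a} = {y \<in> S - {b}. y < a}" by auto
      then have "rank_in (S - {b} - {a}) a = rank_in (S - {b}) a" by (simp add: rank_in_def)
      moreover have "Suc (n - 2) = n - 1" using S by simp
      ultimately show ?thesis
        using rhbs_cost[OF gap_sorted_list_of_set[OF T(1,2)], of c] T(3) n n1 S by simp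
    qed
    then have "(\<Sum>a\<in>S - {b}. real (rhbs a (sorted_list_of_set (S - {b} - {a}))))
      = (\<Sum>a\<in>S - {b}. real (rhbs_gap_cost c (n - 1) (rank_in (S - {b}) a)))" by simp
    also have "\<dots> = (\<Sum>g<n - 1. real (rhbs_gap_cost c (n - 1) g))"
      using sum_rank[OF cd(1)] cd(2) by simp
    also have "\<dots> = real (n - 1) * (real c + 1) - 2 ^ c"
      by (rule rhbs_gap_cost_sum) (use n n1 in auto)
    finally show ?thesis .
  qed
  have second: "(\<Sum>a\<in>S - {b}. real (rhbs b (insort a (sorted_list_of_set (S - {b} - {a})))))
      = real (n - 1) * real (rhbs_gap_cost c n (rank_in S b))" if b: "b \<in> S" for b
  proof -
    have cd: "finite (S - {b})" "card (S - {b}) = n - 1" "b \<notin> S - {b}" using S b by auto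
    have "insort a (sorted_list_of_set (S - {b} - {a})) = sorted_list_of_set (S - {b})"
      if a: "a \<in> S - {b}" for a
      using sorted_list_of_set_insert_remove[OF cd(1), of a] a by (simp add: insert_absorb)
    moreover have "rhbs b (sorted_list_of_set (S - {b})) = rhbs_gap_cost c n (rank_in S b)"
    proof -
      have "{y \<in> S - {b}. y < b} = {y \<in> S. y < b}" by auto
      then have "rank_in (S - {b}) b = rank_in S b" by (simp add: rank_in_def)
      then show ?thesis
        using rhbs_cost[OF gap_sorted_list_of_set[OF cd(1,3)], of c] cd(2) n S by simp
    qed
    ultimately show ?thesis using cd by simp
  qed
  have "(\<Sum>b\<in>S. \<Sum>a\<in>S - {b}. real (rhbs a (sorted_list_of_set (S - {b} - {a}))
      + rhbs b (insort a (sorted_list_of_set (S - {b} - {a})))))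
    = (\<Sum>b\<in>S. real (n - 1) * (real c + 1) - 2 ^ c) + (\<Sum>b\<in>S. real (n - 1) * real (rhbs_gap_cost c n (rank_in S b)))"
    unfolding of_nat_add sum.distrib by (intro arg_cong2[where f = "(+)"] sum.cong refl first second)
  also have "(\<Sum>b\<in>S. real (n - 1) * real (rhbs_gap_cost c n (rank_in S b)))
      = real (n - 1) * (real n * (real c + 1) - 2 ^ c)"
    unfolding sum_distrib_left[symmetric] using sum_rank[OF S(1), of "\<lambda>g. real (rhbs_gap_cost c n g)"] S n
    by (simp add: rhbs_gap_cost_sum)
  finally show ?thesis using S by (simp add: algebra_simps)
qed

lemma pair_sum_bound:
  assumes S: "finite S" "card S = n" "4 \<le> n" and n: "2 ^ c < 2 * n" "n \<le> 2 ^ c"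
  shows "(\<Sum>b\<in>S. \<Sum>a\<in>S - {b}. real (pair_cost a b (sorted_list_of_set (S - {b} - {a}))))
    \<le> real n * (real n - 1) * (2 * (real c + 1 - 2 ^ c / real n) + gain (real n / 2 ^ c) + 100 / real n)"
proof -
  define M :: real where "M = 2 ^ c"
  define x where "x = real n"
  define p where "p = x / M"
  have x4: "4 \<le> x" using S by (simp add: x_def)
  have Mx: "M < 2 * x" "x \<le> M"
    using of_nat_less_iff[where ?'a = real, THEN iffD2, OF n(1)] of_nat_mono[OF n(2), where ?'a = real]
    by (simp_all add: M_def x_def)
  have p: "p = pfrac n" "0 < p"
    using pfrac_eq[OF n] S x4 Mx by (simp_all add: p_def M_def x_def)
  have len: "length (sorted_list_of_set (S - {b} - {a})) + 2 = n" if "b \<in> S" "a \<in> S - {b}" for a b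
    using S that by simp
  show ?thesis
  proof (cases "use_2merge n")
    case True
    define e :: nat where "e = (if 3 * 2 ^ c < 4 * n then 1 else 2)"
    have "(3 * 2 ^ c < 4 * n) \<longleftrightarrow> 3/4 < p"
    proof -
      have "(3 * 2 ^ c < 4 * n) \<longleftrightarrow> real (3 * 2 ^ c) < real (4 * n)" by (simp only: of_nat_less_iff)
      also have "\<dots> \<longleftrightarrow> 3 * M < 4 * x" by (simp add: M_def x_def)
      also have "\<dots> \<longleftrightarrow> 3/4 < p" using x4 Mx by (simp add: p_def field_simps)
      finally show ?thesis .
    qed
    then have e: "e = (if 3/4 < p then 1 else 2)" by (simp add: e_def)
    define X where "X = x - M / 2 ^ e"
    have c2: "2 \<le> c"
    proof (rule ccontr)
      assume "\<not> 2 \<le> c"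
      then have "(2::nat) ^ c \<le> 2 ^ 1" by (intro power_increasing) auto
      then show False using n S by simp
    qed
    have X: "0 \<le> X" "X \<le> x" using Mx x4 by (auto simp: X_def e)
    have ec: "e \<le> 2" "real (c - e) = real c - real e" using c2 by (auto simp: e)
    have "(\<Sum>b\<in>S. \<Sum>a\<in>S - {b}. real (pair_cost a b (sorted_list_of_set (S - {b} - {a}))))
      = (\<Sum>b\<in>S. \<Sum>a\<in>S - {b}. real (twomerge a b (sorted_list_of_set (S - {b} - {a}))))"
      by (intro sum.cong refl) (simp only: pair_cost_def len True if_True)
    also have "\<dots> \<le> 2 * (\<Sum>N<n. real N * (1 + real (search_bound e c n N)) + insert_total N)"
      by (rule sum_twomerge_le[OF S n e_def])
    also have "\<dots> = 2 * (\<Sum>N<n. real N) + 2 * (\<Sum>N<n. real N * real (search_bound e c n N)) + 2 * (\<Sum>N<n. insert_total N)"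
      by (simp add: sum.distrib algebra_simps)
    also have "\<dots> \<le> x * (x - 1) + (real c - real e) * (x * (x - 1)) + (3 * X\<^sup>2 + 3 * X) + 36 * x
       + ((real c + 1) * x * (x - 1) - 2 * M * x + M\<^sup>2 / 3 + M + 2/3)"
    proof -
      have 1: "2 * (\<Sum>N<n. insert_total N) = (real c + 1) * x * (x - 1) - 2 * M * x + M\<^sup>2 / 3 + M + 2/3"
        using sum_insert_total[of n] S ceil_lg_unique[OF n] by (simp add: x_def M_def)
      have 2: "2 * (\<Sum>N<n. real N) = x * (x - 1)" by (simp add: sum_below x_def)
      have "2 * s \<le> q + r + 36 * x" if "s \<le> q / 2 + t + 18 * x" "t \<le> r / 2" for s q r t :: real
        using that by linarith
      from this[OF sum_search_bound_le[where n = n and e = e and c = c, folded x_def,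
            unfolded ec(2) times_divide_eq_right]
          sum_threshold_le[OF ec(1) X_def[unfolded x_def M_def] X(1)]]
      have 3: "2 * (\<Sum>N<n. real N * real (search_bound e c n N))
          \<le> (real c - real e) * (x * (x - 1)) + (3 * X\<^sup>2 + 3 * X) + 36 * x" .
      show ?thesis unfolding 1 2 using 3 by simp
    qed
    also have "\<dots> \<le> x * (x - 1) * (2 * (real c + 1 - M / x) + gain p + 100 / x)"
    proof -
      have g: "gain p = 3 * X\<^sup>2 / x\<^sup>2 + M\<^sup>2 / (3 * x\<^sup>2) - real e"
      proof -
        have "1 - 1 / (2 ^ e * p) = X / x" using x4 Mx by (simp add: X_def p_def field_simps)
        moreover have "1 / (3 * p\<^sup>2) = M\<^sup>2 / (3 * x\<^sup>2)" by (simp add: p_def power_divide)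
        ultimately show ?thesis using gain_use_2merge[OF p True e] by (simp add: power_divide)
      qed
      have "x * (x - 1) * (2 * (real c + 1 - M / x) + gain p + 100 / x)
        = x * (x - 1) * (2 * (real c + 1) - real e) - 2 * M * (x - 1) + 3 * X\<^sup>2 - 3 * (X\<^sup>2 / x) + M\<^sup>2 / 3 - (M\<^sup>2 / x) / 3 + 100 * (x - 1)"
        unfolding g using x4 by (simp add: field_simps power2_eq_square)
      moreover have "X\<^sup>2 / x \<le> x" using X x4 by (simp add: divide_le_eq power2_eq_square mult_mono)
      moreover have "M\<^sup>2 / x \<le> 2 * M" using Mx x4 by (simp add: divide_le_eq power2_eq_square)
      ultimately show ?thesis using X x4 Mx by (simp add: algebra_simps)
    qed
    finally show ?thesis unfolding p_def x_def M_def .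
  next
    case False
    have "(\<Sum>b\<in>S. \<Sum>a\<in>S - {b}. real (pair_cost a b (sorted_list_of_set (S - {b} - {a}))))
      = (\<Sum>b\<in>S. \<Sum>a\<in>S - {b}. real (rhbs a (sorted_list_of_set (S - {b} - {a}))
      + rhbs b (insort a (sorted_list_of_set (S - {b} - {a})))))"
      by (intro sum.cong refl) (simp only: pair_cost_def len False if_False)
    also have "\<dots> = 2 * (real c + 1) * x * (x - 1) - M * (2 * x - 1)"
      using sum_two_insertions[OF S n] by (simp add: x_def M_def)
    also have "\<dots> \<le> x * (x - 1) * (2 * (real c + 1 - M / x) + 0 + 100 / x)"
    proof -
      have "x * (x - 1) * (2 * (real c + 1 - M / x) + 0 + 100 / x)
         = 2 * (real c + 1) * x * (x - 1) - 2 * M * (x - 1) + 100 * (x - 1)"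
        using x4 by (simp add: field_simps)
      then show ?thesis using x4 Mx by (simp add: algebra_simps)
    qed
    also have "0 = gain p" by (rule gain_not_use_2merge[OF p False, symmetric])
    finally show ?thesis unfolding p_def x_def M_def .
  qed
qed

section \<open>The potential and its growth per step\<close>

lemma gain_nonpos: "gain p \<le> 0"
  by (simp add: gain_def)

lemma continuous_on_gain: "continuous_on {1/2..1} gain"
  unfolding gain_def by (intro continuous_intros) auto

text \<open>Since \<open>gain\<close> has kinks, a Lipschitz bound stands in for a derivative. In
  the variable \<open>1 / p\<close>, confined to \<open>[0, 2]\<close>, everything is quadratic with
  slope at most 6; passing back to \<open>p\<close> costs a factor 4.\<close>

lemma gain_lipschitz:
  assumes p: "1/2 \<le> p" "1/2 \<le> q"
  shows "\<bar>gain p - gain q\<bar> \<le> 24 * \<bar>p - q\<bar>"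
proof -
  define v w where "v = 1 / p" and "w = 1 / q"
  define m k where "m = max 0 (1 - 3/4 * v)" and "k = max 0 (1 - 3/4 * w)"
  have vw: "0 < v" "v \<le> 2" "0 < w" "w \<le> 2" using p by (auto simp: v_def w_def field_simps)
  have d: "\<bar>v - w\<bar> \<le> 4 * \<bar>p - q\<bar>"
  proof -
    have "v - w = v * w * (q - p)" using p by (simp add: v_def w_def field_simps)
    then have "\<bar>v - w\<bar> = v * w * \<bar>p - q\<bar>" using vw by (simp add: abs_mult abs_minus_commute)
    also have "\<dots> \<le> 2 * 2 * \<bar>p - q\<bar>" using vw by (intro mult_right_mono mult_mono) auto
    finally show ?thesis by simp
  qed
  have mk: "0 \<le> m" "m \<le> 1" "0 \<le> k" "k \<le> 1" "\<bar>m - k\<bar> \<le> 3/4 * \<bar>v - w\<bar>"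
    using vw by (auto simp: m_def k_def max_def abs_if)
  have sq: "\<bar>a\<^sup>2 - b\<^sup>2\<bar> \<le> r * \<bar>a - b\<bar>" if "0 \<le> a" "0 \<le> b" "a + b \<le> r" for a b r :: real
  proof -
    have "\<bar>a\<^sup>2 - b\<^sup>2\<bar> = (a + b) * \<bar>a - b\<bar>"
      using that by (simp add: power2_eq_square square_diff_square_factored abs_mult)
    then show ?thesis using that by (simp add: mult_right_mono)
  qed
  define f g where "f = 1 - 3/2 * v + 25/48 * v\<^sup>2 + m\<^sup>2" and "g = 1 - 3/2 * w + 25/48 * w\<^sup>2 + k\<^sup>2"
  have "\<bar>gain p - gain q\<bar> = \<bar>min 0 f - min 0 g\<bar>"
    by (simp add: gain_def f_def g_def m_def k_def v_def w_def power_divide)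
  also have "\<dots> \<le> \<bar>f - g\<bar>" by (auto simp: min_def)
  also have "f - g = 25/48 * (v\<^sup>2 - w\<^sup>2) + (m\<^sup>2 - k\<^sup>2) - 3/2 * (v - w)" unfolding f_def g_def by algebra
  also have "\<bar>\<dots>\<bar> \<le> 25/48 * \<bar>v\<^sup>2 - w\<^sup>2\<bar> + \<bar>m\<^sup>2 - k\<^sup>2\<bar> + 3/2 * \<bar>v - w\<bar>"
  proof -
    have "\<bar>25/48 * a + b - 3/2 * c\<bar> \<le> 25/48 * \<bar>a\<bar> + \<bar>b\<bar> + 3/2 * \<bar>c\<bar>" for a b c :: real
      by linarith
    then show ?thesis .
  qed
  also have "\<dots> \<le> 6 * \<bar>v - w\<bar>"
  proof -
    have "25/48 * a + b + 3/2 * c \<le> 6 * c" if "a \<le> 4 * c" "b \<le> 2 * d" "d \<le> 3/4 * c" "0 \<le> c"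
      for a b c d :: real using that by linarith
    from this[OF sq sq mk(5)] show ?thesis using vw mk by simp
  qed
  also have "\<dots> \<le> 24 * \<bar>p - q\<bar>" using d by simp
  finally show ?thesis .
qed

definition gain_integral :: "real \<Rightarrow> real" where
  "gain_integral p = integral {1/2..p} gain"

lemma gain_integral_deriv:
  assumes "p \<in> {1/2..1}"
  shows "(gain_integral has_real_derivative gain p) (at p within {1/2..1})"
  unfolding gain_integral_def[abs_def]
  by (rule integral_has_real_derivative[OF continuous_on_gain assms])

text \<open>An antiderivative of half the limiting pair cost. The terms
  \<open>- 2 ^ c * ln 2\<close> and \<open>2 ^ c / 2 * gain_integral 1\<close> are what all lower
  octaves contribute together: each is a geometric series with ratio 2, summing to as much as the
  whole current octave.\<close>

definition potential :: "nat \<Rightarrow> real \<Rightarrow> real" where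
  "potential c x = x * real c + x - 2 ^ c - 2 ^ c * ln (2 * x / 2 ^ c) - 2 ^ c * ln 2
     + 2 ^ c / 2 * (gain_integral (x / 2 ^ c) + gain_integral 1)"

lemma potential_deriv:
  assumes "x \<in> {2 ^ c / 2..2 ^ c}"
  shows "(potential c has_real_derivative real c + 1 - 2 ^ c / x + gain (x / 2 ^ c) / 2)
    (at x within {2 ^ c / 2..2 ^ c})"
proof -
  define M :: real where "M = 2 ^ c"
  have M: "0 < M" by (simp add: M_def)
  have "M / 2 \<le> x" "x \<le> M" using assms by (auto simp: M_def)
  then have x: "M / 2 \<le> x" "x \<le> M" "0 < x" using M by auto
  have im: "(\<lambda>x. x / M) ` {M / 2..M} = {1/2..1}"
  proof -
    have "y \<in> (\<lambda>x. x / M) ` {M / 2..M}" if "y \<in> {1/2..1}" for y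
      using that M by (intro image_eqI[where x = "y * M"]) (auto simp: field_simps)
    then show ?thesis using M by (auto simp: field_simps)
  qed
  have "(gain_integral has_real_derivative gain (x / M)) (at (x / M) within (\<lambda>x. x / M) ` {M / 2..M})"
    unfolding im using x M by (intro gain_integral_deriv) (auto simp: field_simps)
  moreover have "((\<lambda>x. x / M) has_real_derivative 1 / M) (at x within {M / 2..M})"
    using M by (auto intro!: derivative_eq_intros)
  ultimately have G: "((\<lambda>x. gain_integral (x / M)) has_real_derivative gain (x / M) * (1 / M)) (at x within {M / 2..M})"
    by (rule DERIV_image_chain[unfolded o_def])
  show ?thesis
    unfolding potential_def[abs_def] M_def[symmetric]
    by (rule derivative_eq_intros G refl | use x M in \<open>simp add: field_simps; fail\<close>)+
qed

text \<open>By the mean value theorem the increment over two elements is the pair cost at an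
  intermediate point. Moving that point to \<open>n\<close> costs \<open>2 * 4 / n\<close> for the
  hyperbola and \<open>48 / n\<close> for the gain.\<close>

lemma potential_step:
  assumes n: "2 ^ c < 2 * n" "n \<le> 2 ^ c" "2 ^ c \<le> 2 * (n - 2)" "4 \<le> n"
  shows "2 * (real c + 1 - 2 ^ c / real n) + gain (real n / 2 ^ c)
    \<le> potential c (real n) - potential c (real (n - 2)) + 56 / real n"
proof -
  define M :: real where "M = 2 ^ c"
  define x where "x = real n"
  have rn: "real (n - 2) = x - 2" using n by (simp add: x_def)
  have Mx: "M \<le> 2 * (x - 2)" "x \<le> M" "4 \<le> x"
    using of_nat_mono[OF n(3), where ?'a = real] of_nat_mono[OF n(2), where ?'a = real] n(4) rn
    by (simp_all add: M_def x_def)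
  have "\<exists>y\<in>{x - 2<..<x}. potential c x - potential c (x - 2)
      = (\<lambda>h. (real c + 1 - M / y + gain (y / M) / 2) * h) (x - (x - 2))"
  proof (rule mvt_simple)
    fix y assume y: "x - 2 \<le> y" "y \<le> x"
    have "(potential c has_real_derivative real c + 1 - M / y + gain (y / M) / 2) (at y within {x - 2..x})"
      by (rule has_field_derivative_subset[OF potential_deriv[of y c, folded M_def]])
        (use y Mx in auto)
    then show "(potential c has_derivative (\<lambda>h. (real c + 1 - M / y + gain (y / M) / 2) * h)) (at y within {x - 2..x})"
      by (simp add: has_field_derivative_def)
  qed simp
  then obtain y where y: "x - 2 < y" "y < x"
    and eq: "potential c x - potential c (x - 2) = 2 * (real c + 1 - M / y) + gain (y / M)"
    by auto
  have "M / y - M / x \<le> 4 / x"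
  proof -
    have "M / y - M / x = M * (x - y) / (x * y)" using y Mx by (simp add: field_simps)
    also have "\<dots> \<le> M * 2 / (x * (M / 2))"
      using y Mx by (intro frac_le mult_left_mono mult_mono) auto
    also have "\<dots> = 4 / x" using Mx by simp
    finally show ?thesis .
  qed
  moreover have "gain (x / M) - gain (y / M) \<le> 48 / x"
  proof -
    have "gain (x / M) - gain (y / M) \<le> 24 * \<bar>x / M - y / M\<bar>"
    proof -
      have "1/2 \<le> x / M" "1/2 \<le> y / M" using y Mx by (simp_all add: field_simps)
      from gain_lipschitz[OF this] show ?thesis by linarith
    qed
    also have "\<dots> = 24 * (x - y) / M" using y Mx by (simp add: diff_divide_distrib[symmetric])
    also have "\<dots> \<le> 24 * 2 / x" using y Mx by (intro frac_le) auto
    finally show ?thesis by simp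
  qed
  ultimately have "2 * (real c + 1 - M / x) + gain (x / M) \<le> potential c x - potential c (x - 2) + 56 / x"
    unfolding eq by simp
  then show ?thesis by (simp only: rn M_def x_def)
qed

lemma potential_half: "potential (Suc c) (2 ^ c) = potential c (2 ^ c)"
  by (simp add: potential_def algebra_simps gain_integral_def)

text \<open>Makes the errors of order \<open>1 / n\<close> telescope into a logarithm.\<close>

lemma log2_step:
  assumes "4 \<le> n"
  shows "2 / real n \<le> log 2 (real n) - log 2 (real (n - 2))"
proof -
  define x where "x = real n"
  have rn: "real (n - 2) = x - 2" and x: "4 \<le> x" using assms by (simp_all add: x_def)
  have "ln (x - 2) - ln x = ln ((x - 2) / x)" using x by (simp add: ln_div)
  also have "\<dots> \<le> (x - 2) / x - 1" using x by (intro ln_le_minus_one) simp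
  finally have l: "2 / x \<le> ln x - ln (x - 2)" using x by (simp add: field_simps)
  have "2 / x \<le> (2 / x) / ln 2"
    using x ln_2_less_1 by (simp add: le_divide_eq mult_left_le)
  also have "\<dots> \<le> (ln x - ln (x - 2)) / ln 2" using l by (intro divide_right_mono) auto
  also have "\<dots> = log 2 x - log 2 (x - 2)" by (simp add: log_def diff_divide_distrib)
  finally show ?thesis by (simp only: rn x_def)
qed

text \<open>The constant 78 is half of \<open>100 + 56\<close>, the errors from the pair average and
  from the potential step; the half matches the increment \<open>2 / n\<close> of the logarithm. The
  absolute value offsets a possibly negative potential at \<open>n = 2\<close>.\<close>

lemma total_cost_le:
  assumes "finite S" "card S = n" "even n" "2 \<le> n"
  shows "total_cost S \<le> fact n * (potential (ceil_lg n) (real n) + 78 * log 2 (real n) + \<bar>potential 1 2\<bar>)"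
  using assms
proof (induction n arbitrary: S rule: less_induct)
  case (less n)
  show ?case
  proof (cases "n = 2")
    case True
    have "ceil_lg 2 = 1" by (rule ceil_lg_unique) auto
    have "total_cost S = (\<Sum>s\<in>permutations_of_set S. 1)"
      unfolding total_cost_def
    proof (intro sum.cong refl)
      fix s assume "s \<in> permutations_of_set S"
      then have "length s = 2" using less.prems True by (simp add: length_finite_permutations_of_set)
      then show "real (ins12 s) = 1" by (subst ins12.simps) simp
    qed
    also have "\<dots> = 2" using less.prems True by simp
    finally show ?thesis using True \<open>ceil_lg 2 = 1\<close> by simp
  next
    case False
    then have n4: "4 \<le> n" using less.prems by presburger
    define c where "c = ceil_lg n"
    have n: "2 ^ c < 2 * n" "n \<le> 2 ^ c" using ceil_lg[of n] n4 by (simp_all add: c_def)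
    obtain d where d: "c = Suc (Suc d)"
    proof -
      have "\<not> c < 2"
      proof
        assume "c < 2"
        then have "(2::nat) ^ c \<le> 2 ^ 1" by (intro power_increasing) auto
        then show False using n n4 by simp
      qed
      then show ?thesis using that[of "c - 2"] by simp
    qed
    obtain k where k: "n = 2 * k" using less.prems by blast
    \<comment> \<open>Here evenness of \<open>n\<close> matters: \<open>n\<close> exceeds the even
      number \<open>2 ^ c / 2\<close>, hence does so by at least 2.\<close>
    have half: "2 ^ c \<le> 2 * (n - 2)"
    proof -
      have "2 * 2 ^ d < 2 * k" using n by (simp add: d k)
      then show ?thesis by (simp add: d k)
    qed
    define w where "w = potential (ceil_lg (n - 2)) (real (n - 2)) + 78 * log 2 (real (n - 2)) + \<bar>potential 1 2\<bar>"
    \<comment> \<open>If \<open>n - 2\<close> is itself a power of two it belongs to the lower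
      octave, where the potential has the same value.\<close>
    have pot: "potential (ceil_lg (n - 2)) (real (n - 2)) = potential c (real (n - 2))"
    proof (cases "2 ^ c = 2 * (n - 2)")
      case True
      then have e: "n - 2 = 2 ^ Suc d" by (simp add: d)
      have "ceil_lg (n - 2) = Suc d" unfolding e by (rule ceil_lg_unique) auto
      then show ?thesis using potential_half[of "Suc d"] by (simp add: e d)
    next
      case False
      then have "ceil_lg (n - 2) = c" using half n by (intro ceil_lg_unique) auto
      then show ?thesis by simp
    qed
    define g where "g = 2 * (real c + 1 - 2 ^ c / real n) + gain (real n / 2 ^ c) + 100 / real n"
    have "total_cost S = (\<Sum>b\<in>S. \<Sum>a\<in>S - {b}. total_cost (S - {b} - {a})
      + fact (n - 2) * real (pair_cost a b (sorted_list_of_set (S - {b} - {a}))))"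
      by (rule total_cost_rec) (use less.prems n4 in auto)
    also have "\<dots> \<le> (\<Sum>b\<in>S. \<Sum>a\<in>S - {b}. fact (n - 2) * w
      + fact (n - 2) * real (pair_cost a b (sorted_list_of_set (S - {b} - {a}))))"
    proof (intro sum_mono add_right_mono)
      fix a b assume "b \<in> S" "a \<in> S - {b}"
      then show "total_cost (S - {b} - {a}) \<le> fact (n - 2) * w"
        unfolding w_def by (intro less.IH) (use less.prems n4 in auto)
    qed
    also have "\<dots> = real n * (real n - 1) * (fact (n - 2) * w) + fact (n - 2) *
        (\<Sum>b\<in>S. \<Sum>a\<in>S - {b}. real (pair_cost a b (sorted_list_of_set (S - {b} - {a}))))"
      using less.prems n4 by (simp add: sum.distrib sum_distrib_left)
    also have "\<dots> \<le> real n * (real n - 1) * (fact (n - 2) * w) + fact (n - 2) * (real n * (real n - 1) * g)"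
      unfolding g_def
      by (intro add_left_mono mult_left_mono pair_sum_bound[OF less.prems(1,2) n4 n]) auto
    also have "\<dots> = fact n * (w + g)"
    proof -
      have "fact n = real n * (real (n - 1) * fact (n - 2))"
        using n4 fact_reduce[of n, where ?'a = real] fact_reduce[of "n - 1", where ?'a = real]
        by (simp add: numeral_2_eq_2)
      moreover have "real (n - 1) = real n - 1" using n4 by simp
      ultimately show ?thesis by (simp only:) (simp add: algebra_simps)
    qed
    also have "\<dots> \<le> fact n * (potential (ceil_lg n) (real n) + 78 * log 2 (real n) + \<bar>potential 1 2\<bar>)"
    proof (intro mult_left_mono)
      have "g \<le> potential c (real n) - potential c (real (n - 2)) + 78 * (2 / real n)"
        using potential_step[OF n half n4] unfolding g_def by simp
      also have "\<dots> \<le> potential c (real n) - potential c (real (n - 2)) + 78 * (log 2 (real n) - log 2 (real (n - 2)))"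
        using log2_step[OF n4] by (intro add_left_mono mult_left_mono) auto
      finally show "w + g \<le> potential (ceil_lg n) (real n) + 78 * log 2 (real n) + \<bar>potential 1 2\<bar>"
        unfolding w_def pot c_def[symmetric] by simp
    qed simp
    finally show ?thesis .
  qed
qed

section \<open>Numerical proof that the excess is nonpositive\<close>

lemma ln_le_cubic:
  fixes x :: real
  assumes "0 < x"
  shows "ln x \<le> (x - 1) - (x - 1)\<^sup>2 / 2 + (x - 1) ^ 3 / 3"
proof -
  define f where "f y = (y - 1) - (y - 1)\<^sup>2 / 2 + (y - 1) ^ 3 / 3 - ln y" for y :: real
  \<comment> \<open>The derivative has the sign of \<open>y - 1\<close>, so \<open>f\<close> is
    smallest at 1, where it vanishes.\<close>
  have der: "(f has_real_derivative (y - 1) ^ 3 / y) (at y)" if "0 < y" for y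
  proof -
    have "(f has_real_derivative 1 - (y - 1) + (y - 1)\<^sup>2 - 1 / y) (at y)"
      unfolding f_def[abs_def] by (auto intro!: derivative_eq_intros simp: that field_simps)
    moreover have "1 - (y - 1) + (y - 1)\<^sup>2 - 1 / y = (y - 1) ^ 3 / y"
      using that by (simp add: field_simps power2_eq_square power3_eq_cube)
    ultimately show ?thesis by simp
  qed
  have "f 1 \<le> f x"
  proof (cases "1 \<le> x")
    case True
    then show ?thesis
    proof (rule DERIV_nonneg_imp_nondecreasing)
      fix y assume "1 \<le> y" "y \<le> x"
      then show "\<exists>z. (f has_real_derivative z) (at y) \<and> 0 \<le> z"
        by (intro exI[of _ "(y - 1) ^ 3 / y"] conjI der) auto
    qed
  next
    case False
    then have "x \<le> 1" by simp
    then show ?thesis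
    proof (rule DERIV_nonpos_imp_nonincreasing)
      fix y assume y: "x \<le> y" "y \<le> 1"
      then have "(y - 1) ^ 3 \<le> 0" by (simp add: power3_eq_cube mult_nonneg_nonpos2 mult_nonneg_nonpos zero_le_mult_iff mult_le_0_iff)
      then show "\<exists>z. (f has_real_derivative z) (at y) \<and> z \<le> 0"
        using y assms by (intro exI[of _ "(y - 1) ^ 3 / y"] conjI der) (auto intro: divide_nonpos_nonneg)
    qed
  qed
  then show ?thesis by (simp add: f_def)
qed

text \<open>The hypotheses \<open>B0\<close> to \<open>B4\<close> bound the Bernstein coefficients with respect to \<open>[a, b]\<close>.\<close>

lemma quartic_nonpos:
  fixes a b p :: real
  assumes p: "a \<le> p" "p \<le> b" "a < b"
    and B0: "c0 + c1 * a + c2 * a\<^sup>2 + c3 * a ^ 3 + c4 * a ^ 4 \<le> 0"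
    and B1: "c0 + c1 * (3 * a + b) / 4 + c2 * (a\<^sup>2 + a * b) / 2 + c3 * (a ^ 3 + 3 * a\<^sup>2 * b) / 4 + c4 * a ^ 3 * b \<le> 0"
    and B2: "c0 + c1 * (a + b) / 2 + c2 * (a\<^sup>2 + 4 * a * b + b\<^sup>2) / 6 + c3 * (a\<^sup>2 * b + a * b\<^sup>2) / 2 + c4 * a\<^sup>2 * b\<^sup>2 \<le> 0"
    and B3: "c0 + c1 * (a + 3 * b) / 4 + c2 * (b\<^sup>2 + a * b) / 2 + c3 * (b ^ 3 + 3 * b\<^sup>2 * a) / 4 + c4 * b ^ 3 * a \<le> 0"
    and B4: "c0 + c1 * b + c2 * b\<^sup>2 + c3 * b ^ 3 + c4 * b ^ 4 \<le> 0"
  shows "c0 + c1 * p + c2 * p\<^sup>2 + c3 * p ^ 3 + c4 * p ^ 4 \<le> 0"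
proof -
  define t u where "t = b - p" and "u = p - a"
  have tu: "0 \<le> t" "0 \<le> u" using p by (simp_all add: t_def u_def)
  \<comment> \<open>The brackets are the values of the polar form of the quartic with some arguments
    equal to \<open>a\<close> and the others to \<open>b\<close>.\<close>
  have "(b - a) ^ 4 * (c0 + c1 * p + c2 * p\<^sup>2 + c3 * p ^ 3 + c4 * p ^ 4) =
      (c0 + c1 * a + c2 * a\<^sup>2 + c3 * a ^ 3 + c4 * a ^ 4) * t ^ 4
    + (c0 + c1 * (3 * a + b) / 4 + c2 * (a\<^sup>2 + a * b) / 2 + c3 * (a ^ 3 + 3 * a\<^sup>2 * b) / 4 + c4 * a ^ 3 * b) * (4 * t ^ 3 * u)
    + (c0 + c1 * (a + b) / 2 + c2 * (a\<^sup>2 + 4 * a * b + b\<^sup>2) / 6 + c3 * (a\<^sup>2 * b + a * b\<^sup>2) / 2 + c4 * a\<^sup>2 * b\<^sup>2) * (6 * t\<^sup>2 * u\<^sup>2)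
    + (c0 + c1 * (a + 3 * b) / 4 + c2 * (b\<^sup>2 + a * b) / 2 + c3 * (b ^ 3 + 3 * b\<^sup>2 * a) / 4 + c4 * b ^ 3 * a) * (4 * t * u ^ 3)
    + (c0 + c1 * b + c2 * b\<^sup>2 + c3 * b ^ 3 + c4 * b ^ 4) * u ^ 4"
    unfolding t_def u_def by algebra
  also have "\<dots> \<le> 0"
  proof -
    have "x0 * t ^ 4 + x1 * (4 * t ^ 3 * u) + x2 * (6 * t\<^sup>2 * u\<^sup>2) + x3 * (4 * t * u ^ 3) + x4 * u ^ 4 \<le> 0"
      if "x0 \<le> 0" "x1 \<le> 0" "x2 \<le> 0" "x3 \<le> 0" "x4 \<le> 0" for x0 x1 x2 x3 x4
      using tu that by (intro add_nonpos_nonpos mult_nonpos_nonneg) auto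
    from this[OF B0 B1 B2 B3 B4] show ?thesis .
  qed
  finally show ?thesis using p by (simp add: mult_le_0_iff)
qed

text \<open>An upper bound for the integral is enough, so \<open>gain\<close> may be replaced by any
  majorant with an explicit antiderivative. This avoids integrating up to the irrational roots of
  \<open>gain\<close>.\<close>

lemma gain_integral_diff_le:
  assumes ab: "1/2 \<le> a" "a \<le> b" "b \<le> 1"
    and E: "\<And>x. a \<le> x \<Longrightarrow> x \<le> b \<Longrightarrow> (E has_real_derivative e x) (at x)"
    and le: "\<And>x. a \<le> x \<Longrightarrow> x \<le> b \<Longrightarrow> gain x \<le> e x"
  shows "gain_integral b - gain_integral a \<le> E b - E a"
proof (cases "a = b")
  case False
  have "\<exists>y\<in>{a<..<b}. (E b - gain_integral b) - (E a - gain_integral a) = (\<lambda>h. (e y - gain y) * h) (b - a)"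
  proof (rule mvt_simple)
    fix y assume y: "a \<le> y" "y \<le> b"
    have "(gain_integral has_real_derivative gain y) (at y within {a..b})"
      by (rule has_field_derivative_subset[OF gain_integral_deriv]) (use y ab in auto)
    then have "((\<lambda>x. E x - gain_integral x) has_real_derivative e y - gain y) (at y within {a..b})"
      using E[OF y] by (intro derivative_intros) (auto intro: has_field_derivative_at_within)
    then show "((\<lambda>x. E x - gain_integral x) has_derivative (\<lambda>h. (e y - gain y) * h)) (at y within {a..b})"
      by (simp add: has_field_derivative_def)
  qed (use ab False in auto)
  then obtain y where y: "a < y" "y < b"
    and eq: "(E b - gain_integral b) - (E a - gain_integral a) = (e y - gain y) * (b - a)" by auto
  have "0 \<le> (e y - gain y) * (b - a)" using le[of y] y by (intro mult_nonneg_nonneg) auto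
  then show ?thesis using eq by linarith
qed simp

lemma gain_integral_half: "gain_integral (1/2) = 0"
  by (simp add: gain_integral_def)

lemma gain_integral_antimono:
  assumes "1/2 \<le> a" "a \<le> b" "b \<le> 1"
  shows "gain_integral b \<le> gain_integral a"
  using gain_integral_diff_le[OF assms, of "\<lambda>_. 0" "\<lambda>_. 0"] by (auto simp: gain_nonpos)

lemma gain_integral_nonpos:
  assumes "1/2 \<le> p" "p \<le> 1"
  shows "gain_integral p \<le> 0"
  using gain_integral_antimono[of "1/2" p] assms by (simp add: gain_integral_half)

lemma gain_integral_diff_low:
  assumes "1/2 \<le> a" "a \<le> b" "b \<le> 3/4"
  shows "gain_integral b - gain_integral a
    \<le> (b - 3/2 * ln b - 25/48 / b) - (a - 3/2 * ln a - 25/48 / a)"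
proof (rule gain_integral_diff_le)
  fix x assume x: "a \<le> x" "x \<le> b"
  show "((\<lambda>x. x - 3/2 * ln x - 25/48 / x) has_real_derivative ((x - 3/4)\<^sup>2 - 1/24) / x\<^sup>2) (at x)"
    using x assms by (auto intro!: derivative_eq_intros simp: field_simps power2_eq_square)
  show "gain x \<le> ((x - 3/4)\<^sup>2 - 1/24) / x\<^sup>2"
    using gain_low[of x] x assms by simp
qed (use assms in auto)

lemma gain_integral_diff_high:
  assumes "3/4 \<le> a" "a \<le> b" "b \<le> 1"
  shows "gain_integral b - gain_integral a
    \<le> (2 * b - 3 * ln b - 13/12 / b) - (2 * a - 3 * ln a - 13/12 / a)"
proof (rule gain_integral_diff_le)
  fix x assume x: "a \<le> x" "x \<le> b"
  show "((\<lambda>x. 2 * x - 3 * ln x - 13/12 / x) has_real_derivative 2 * ((x - 3/4)\<^sup>2 - 1/48) / x\<^sup>2) (at x)"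
    using x assms by (auto intro!: derivative_eq_intros simp: field_simps power2_eq_square)
  show "gain x \<le> 2 * ((x - 3/4)\<^sup>2 - 1/48) / x\<^sup>2"
    using gain_high[of x] x assms by simp
qed (use assms in auto)

lemma ln_2_bounds: "693147/1000000 \<le> ln (2::real)" "ln (2::real) \<le> 173287/250000"
  using ln_approx_bounds[of 2 6] by (simp_all add: eval_nat_numeral)

text \<open>The arguments are quotients of \<open>3/4\<close>, 1 and two rational stand-ins for the
  roots of \<open>gain\<close>: \<open>6/11\<close> just below the left root and
  \<open>17/19\<close> just above the right one.\<close>

lemma ln_lower_bounds:
  "318453/1000000 \<le> ln (11/8::real)"
  "176456/1000000 \<le> ln (68/57::real)"
  "606135/1000000 \<le> ln (11/6::real)"
  "287682/1000000 \<le> ln (4/3::real)"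
proof -
  show "318453/1000000 \<le> ln (11/8::real)"
    using ln_approx_bounds[of "11/8" 4] by (simp add: eval_nat_numeral)
  show "176456/1000000 \<le> ln (68/57::real)"
    using ln_approx_bounds[of "68/57" 4] by (simp add: eval_nat_numeral)
  show "606135/1000000 \<le> ln (11/6::real)"
    using ln_approx_bounds[of "11/6" 5] by (simp add: eval_nat_numeral)
  show "287682/1000000 \<le> ln (4/3::real)"
    using ln_approx_bounds[of "4/3" 4] by (simp add: eval_nat_numeral)
qed

lemma ln_upper_bounds:
  "ln (20/13::real) \<le> 430783/1000000"
  "ln (50/43::real) \<le> 150823/1000000"
  "ln (200/181::real) \<le> 99821/1000000"
proof -
  show "ln (20/13::real) \<le> 430783/1000000"
    using ln_approx_bounds[of "20/13" 5] by (simp add: eval_nat_numeral)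
  show "ln (50/43::real) \<le> 150823/1000000"
    using ln_approx_bounds[of "50/43" 4] by (simp add: eval_nat_numeral)
  show "ln (200/181::real) \<le> 99821/1000000"
    using ln_approx_bounds[of "200/181" 4] by (simp add: eval_nat_numeral)
qed

text \<open>For \<open>n = p * 2 ^ c\<close>, the potential exceeds the claimed bound by \<open>2 ^ c * excess p\<close>.\<close>

definition excess :: "real \<Rightarrow> real" where
  "excess p = 2.4034 * p - 1 - 2 * ln 2 - ln p - p * log 2 p + (gain_integral p + gain_integral 1) / 2"

text \<open>Expanding \<open>- ln p = ln (q / p) + ln (1 / q)\<close> with the cubic bound gives a
  cubic in \<open>1 / p\<close>, so \<open>p ^ 3\<close> clears all denominators and leaves a
  quartic. This direction works since \<open>- ln p\<close> enters with the nonnegative factor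
  \<open>1 + \<delta> + p / ln 2\<close>. The number \<open>11/6\<close> is
  \<open>1 + 1/2 + 1/3\<close>; the parameters describe an upper bound for the integral terms, and
  \<open>q\<close> is the point where the cubic is exact.\<close>

lemma excess_nonpos_if_quartic:
  fixes p q m \<alpha> \<beta> \<gamma> \<delta> :: real
  assumes q: "0 < q" "ln (1 / q) \<le> m"
    and p: "0 < p" "p \<le> 1"
    and J: "(gain_integral p + gain_integral 1) / 2 \<le> \<alpha> * p + \<beta> + \<gamma> / p - \<delta> * ln p" "0 \<le> \<delta>"
    and poly: "(1 + \<delta>) * (q ^ 3 / 3) + ((1 + \<delta>) * (- (3/2) * q\<^sup>2) + 1.442696 * (q ^ 3 / 3)) * p
      + (\<gamma> + (1 + \<delta>) * (3 * q) + 1.442696 * (- (3/2) * q\<^sup>2)) * p\<^sup>2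
      + (\<beta> - 1 - 2 * 0.693147 + (1 + \<delta>) * (m - 11/6) + 1.442696 * (3 * q)) * p ^ 3
      + (2.4034 + \<alpha> + 1.442696 * (m - 11/6)) * p ^ 4 \<le> 0"
  shows "excess p \<le> 0"
proof -
  define t where "t = m - 11/6 + 3 * q / p - 3/2 * q\<^sup>2 / p\<^sup>2 + q ^ 3 / (3 * p ^ 3)"
  have "- ln p = ln (q / p) + ln (1 / q)" using p q by (simp add: ln_div)
  also have "\<dots> \<le> (q / p - 1) - (q / p - 1)\<^sup>2 / 2 + (q / p - 1) ^ 3 / 3 + m"
    using p q by (intro add_mono ln_le_cubic) auto
  also have "\<dots> = t" using p by (simp add: t_def field_simps power2_eq_square power3_eq_cube)
  finally have lt: "- ln p \<le> t" .
  have l0: "0 \<le> - ln p" using p by simp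
  have L: "1 / ln 2 \<le> (1.442696::real)"
  proof -
    have "1 / ln 2 \<le> 1 / (693147/1000000 :: real)" using ln_2_bounds(1) by (intro frac_le) auto
    then show ?thesis by simp
  qed
  have "(1 + \<delta> + p * (1 / ln 2)) * (- ln p) \<le> (1 + \<delta> + p * 1.442696) * t"
    using p J(2) l0 lt by (intro mult_mono add_mono mult_left_mono L) auto
  then have "excess p \<le> (2.4034 + \<alpha>) * p + (\<beta> - 1 - 2 * 0.693147) + \<gamma> / p + (1 + \<delta> + p * 1.442696) * t"
    using J(1) ln_2_bounds(1) unfolding excess_def log_def by (simp add: algebra_simps)
  also have "\<dots> \<le> 0"
  proof -
    have "p ^ 3 * ((2.4034 + \<alpha>) * p + (\<beta> - 1 - 2 * 0.693147) + \<gamma> / p + (1 + \<delta> + p * 1.442696) * t) \<le> 0"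
    proof -
      have T: "p ^ 3 * t = (m - 11/6) * p ^ 3 + (3 * q) * p\<^sup>2 + (- (3/2) * q\<^sup>2) * p + q ^ 3 / 3"
        using p by (simp add: t_def field_simps power2_eq_square power3_eq_cube)
      have G: "p ^ 3 * (\<gamma> / p) = \<gamma> * p\<^sup>2" using p by (simp add: power2_eq_square power3_eq_cube)
      have "p ^ 3 * ((2.4034 + \<alpha>) * p + (\<beta> - 1 - 2 * 0.693147) + \<gamma> / p + (1 + \<delta> + p * 1.442696) * t)
        = (2.4034 + \<alpha>) * p ^ 4 + (\<beta> - 1 - 2 * 0.693147) * p ^ 3 + p ^ 3 * (\<gamma> / p) + (1 + \<delta> + p * 1.442696) * (p ^ 3 * t)"
        by (simp add: algebra_simps power3_eq_cube power4_eq_xxxx)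
      also have "\<dots> = (1 + \<delta>) * (q ^ 3 / 3) + ((1 + \<delta>) * (- (3/2) * q\<^sup>2) + 1.442696 * (q ^ 3 / 3)) * p
        + (\<gamma> + (1 + \<delta>) * (3 * q) + 1.442696 * (- (3/2) * q\<^sup>2)) * p\<^sup>2
        + (\<beta> - 1 - 2 * 0.693147 + (1 + \<delta>) * (m - 11/6) + 1.442696 * (3 * q)) * p ^ 3
        + (2.4034 + \<alpha> + 1.442696 * (m - 11/6)) * p ^ 4"
      proof -
        have "a * p ^ 4 + b * p ^ 3 + g * p\<^sup>2 + (d + p * l) * (t3 * p ^ 3 + t2 * p\<^sup>2 + t1 * p + t0)
          = d * t0 + (d * t1 + l * t0) * p + (g + d * t2 + l * t1) * p\<^sup>2 + (b + d * t3 + l * t2) * p ^ 3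
            + (a + l * t3) * p ^ 4" for a b g d l t0 t1 t2 t3
          by algebra
        then show ?thesis unfolding T G .
      qed
      finally show ?thesis using poly by simp
    qed
    then show ?thesis using p by (simp add: mult_le_0_iff)
  qed
  finally show ?thesis .
qed

lemma gain_integral_three_quarters: "gain_integral (3/4) \<le> - 0.012717"
proof -
  have "gain_integral (3/4) - gain_integral (6/11) \<le>
      (3/4 - 3/2 * ln (3/4) - 25/48 / (3/4)) - (6/11 - 3/2 * ln (6/11) - 25/48 / (6/11))"
    by (rule gain_integral_diff_low) auto
  moreover have "ln (3/4) - ln (6/11) = ln (11/8 :: real)" using ln_div[of "3/4" "6/11 :: real"] by simp
  moreover have "gain_integral (6/11) \<le> 0" by (rule gain_integral_nonpos) auto
  ultimately show ?thesis using ln_lower_bounds(1) by simp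
qed

lemma gain_integral_tail:
  assumes "17/19 \<le> p" "p \<le> 1"
  shows "gain_integral p \<le> - 0.018951"
proof -
  have "gain_integral (17/19) - gain_integral (3/4) \<le>
      (2 * (17/19) - 3 * ln (17/19) - 13/12 / (17/19)) - (2 * (3/4) - 3 * ln (3/4) - 13/12 / (3/4))"
    by (rule gain_integral_diff_high) auto
  moreover have "ln (17/19) - ln (3/4) = ln (68/57 :: real)" using ln_div[of "17/19" "3/4 :: real"] by simp
  moreover have "gain_integral p \<le> gain_integral (17/19)"
    by (rule gain_integral_antimono) (use assms in auto)
  ultimately show ?thesis using gain_integral_three_quarters ln_lower_bounds(2) by simp
qed

lemma excess_nonpos:
  assumes "1/2 \<le> p" "p \<le> 1"
  shows "excess p \<le> 0"
proof -
  have J1: "gain_integral 1 \<le> - 0.018951" by (rule gain_integral_tail) auto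
  have p0: "0 < p" using assms by simp
  \<comment> \<open>The breaks are the kink \<open>3/4\<close> of the gain formula and the stand-ins
    for its roots. The extra break at \<open>91/100\<close> only shortens the Bernstein intervals,
    as both sides use the same quartic.\<close>
  consider "p \<le> 6/11" | "6/11 \<le> p" "p \<le> 3/4" | "3/4 \<le> p" "p \<le> 17/19"
    | "17/19 \<le> p" "p \<le> 91/100" | "91/100 \<le> p" by linarith
  then show ?thesis
  proof cases
    case 1
    show ?thesis
    proof (rule excess_nonpos_if_quartic[OF _ _ p0 assms(2), where q = "1/2" and m = "173287/250000" and \<alpha> = 0 and \<beta> = "-18951/2000000" and \<gamma> = 0 and \<delta> = 0])
      show "ln (1 / (1/2)) \<le> (173287/250000 :: real)" using ln_2_bounds ln_upper_bounds by simp
      show "(gain_integral p + gain_integral 1) / 2 \<le> 0 * p + - 18951 / 2000000 + 0 / p - 0 * ln p"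
        using gain_integral_nonpos[OF assms] J1 by simp
    qed (simp, simp, rule quartic_nonpos[where a = "1/2" and b = "273/500"], use 1 assms in \<open>simp_all add: power_divide\<close>)
  next
    case 2
    show ?thesis
    \<comment> \<open>The parameters \<alpha>, \<gamma> and \<delta> are half the coefficients of
      the antiderivative of the low branch; \<beta> collects half its value at \<open>6/11\<close>
      and half the bound on \<open>gain_integral 1\<close>. The Bernstein interval starts at
      \<open>109/200\<close>, slightly left of \<open>6/11\<close>, for a short decimal.\<close>
    proof (rule excess_nonpos_if_quartic[OF _ _ p0 assms(2), where q = "13/20" and m = "430783/1000000" and \<alpha> = "1/2" and \<beta> = "-259373/1000000" and \<gamma> = "-25/96" and \<delta> = "3/4"])
      show "ln (1 / (13/20)) \<le> (430783/1000000 :: real)" using ln_2_bounds ln_upper_bounds by simp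
      have "gain_integral p - gain_integral (6/11) \<le>
          (p - 3/2 * ln p - 25/48 / p) - (6/11 - 3/2 * ln (6/11) - 25/48 / (6/11))"
        by (rule gain_integral_diff_low) (use 2 in auto)
      moreover have "gain_integral (6/11) \<le> 0" by (rule gain_integral_nonpos) auto
      moreover have "- ln (6/11) = ln (11/6 :: real)" using ln_inverse[of "6/11 :: real"] by simp
      ultimately show "(gain_integral p + gain_integral 1) / 2 \<le> 1/2 * p + - 259373 / 1000000 + - 25/96 / p - 3/4 * ln p"
        using J1 ln_lower_bounds(3) by (simp add: field_simps)
    qed (simp, simp, rule quartic_nonpos[where a = "109/200" and b = "3/4"], use 2 assms in \<open>simp_all add: power_divide\<close>)
  next
    case 3
    show ?thesis
    proof (rule excess_nonpos_if_quartic[OF _ _ p0 assms(2), where q = "43/50" and m = "150823/1000000" and \<alpha> = 1 and \<beta> = "-237567/500000" and \<gamma> = "-13/24" and \<delta> = "3/2"])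
      show "ln (1 / (43/50)) \<le> (150823/1000000 :: real)" using ln_2_bounds ln_upper_bounds by simp
      have "gain_integral p - gain_integral (3/4) \<le>
          (2 * p - 3 * ln p - 13/12 / p) - (2 * (3/4) - 3 * ln (3/4) - 13/12 / (3/4))"
        by (rule gain_integral_diff_high) (use 3 in auto)
      moreover have "- ln (3/4) = ln (4/3 :: real)" using ln_inverse[of "3/4 :: real"] by simp
      ultimately show "(gain_integral p + gain_integral 1) / 2 \<le> 1 * p + - 237567 / 500000 + - 13/24 / p - 3/2 * ln p"
        using J1 gain_integral_three_quarters ln_lower_bounds(4) by (simp add: field_simps)
    qed (simp, simp, rule quartic_nonpos[where a = "3/4" and b = "179/200"], use 3 assms in \<open>simp_all add: power_divide\<close>)
  next
    case 4
    show ?thesis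
    \<comment> \<open>The expansion point \<open>181/200\<close> sits where the margin is smallest,
      so the cubic bound loses almost nothing there.\<close>
    proof (rule excess_nonpos_if_quartic[OF _ _ p0 assms(2), where q = "181/200" and m = "99821/1000000" and \<alpha> = 0 and \<beta> = "-18951/1000000" and \<gamma> = 0 and \<delta> = 0])
      show "ln (1 / (181/200)) \<le> (99821/1000000 :: real)" using ln_2_bounds ln_upper_bounds by simp
      show "(gain_integral p + gain_integral 1) / 2 \<le> 0 * p + - 18951 / 1000000 + 0 / p - 0 * ln p"
        using gain_integral_tail[of p] 4 J1 by simp
    qed (simp, simp, rule quartic_nonpos[where a = "447/500" and b = "91/100"], use 4 assms in \<open>simp_all add: power_divide\<close>)
  next
    case 5
    show ?thesis
    proof (rule excess_nonpos_if_quartic[OF _ _ p0 assms(2), where q = "181/200" and m = "99821/1000000" and \<alpha> = 0 and \<beta> = "-18951/1000000" and \<gamma> = 0 and \<delta> = 0])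
      show "ln (1 / (181/200)) \<le> (99821/1000000 :: real)" using ln_2_bounds ln_upper_bounds by simp
      show "(gain_integral p + gain_integral 1) / 2 \<le> 0 * p + - 18951 / 1000000 + 0 / p - 0 * ln p"
        using gain_integral_tail[of p] 5 assms J1 by simp
    qed (simp, simp, rule quartic_nonpos[where a = "91/100" and b = 1], use 5 assms in \<open>simp_all add: power_divide\<close>)
  qed
qed

section \<open>From the excess to the bound on the complexity\<close>

lemma potential_le:
  assumes n: "2 ^ c < 2 * n" "n \<le> 2 ^ c"
  shows "potential c (real n) \<le> real n * log 2 (real n) - 1.4034 * real n"
proof -
  define M :: real where "M = 2 ^ c"
  define p where "p = real n / M"
  have M: "0 < M" by (simp add: M_def)
  have "real (2 ^ c) < real (2 * n)" "real n \<le> real (2 ^ c)" using n by (simp_all only: of_nat_less_iff of_nat_le_iff)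
  then have p: "1/2 \<le> p" "p \<le> 1" using M by (simp_all add: p_def M_def field_simps)
  have np: "real n = p * M" using M by (simp add: p_def)
  have l: "log 2 (p * M) = log 2 p + real c" using p M by (simp add: log_mult M_def log_nat_power)
  have "ln (2 * (p * M) / M) = ln 2 + ln p" using p M by (simp add: ln_mult)
  then have "potential c (real n) - (real n * log 2 (real n) - 1.4034 * real n) = M * excess p"
    unfolding potential_def excess_def np M_def[symmetric] l using M by (simp add: algebra_simps)
  also have "\<dots> \<le> 0" using excess_nonpos[OF p] M by (simp add: mult_le_0_iff)
  finally show ?thesis by simp
qed

theorem theorem2:
  shows "\<exists>C::real. \<forall>n::nat. even n \<and> 2 \<le> n \<longrightarrow>
           complexity n \<le> real n * log 2 (real n) - 1.4034 * real n + C * log 2 (real n)"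
proof (intro exI allI impI)
  fix n :: nat
  assume n: "even n \<and> 2 \<le> n"
  have "complexity n = total_cost {0..<n} / fact n"
    by (simp add: complexity_def total_cost_def)
  also have "\<dots> \<le> potential (ceil_lg n) (real n) + 78 * log 2 (real n) + \<bar>potential 1 2\<bar>"
    using total_cost_le[of "{0..<n}" n] n by (simp add: divide_le_eq mult.commute)
  also have "potential (ceil_lg n) (real n) \<le> real n * log 2 (real n) - 1.4034 * real n"
    by (rule potential_le) (use n ceil_lg[of n] in auto)
  also have "\<bar>potential 1 2\<bar> \<le> \<bar>potential 1 2\<bar> * log 2 (real n)"
  proof -
    have "1 \<le> log 2 (real n)" using n by (simp add: le_log_iff)
    then show ?thesis by (simp add: mult_le_cancel_left1)
  qed
  finally show "complexity n \<le> real n * log 2 (real n) - 1.4034 * real n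
      + (78 + \<bar>potential 1 2\<bar>) * log 2 (real n)"
    by (simp add: algebra_simps)
qed

end
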